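(* For every integer $k\ge 1$ there exists a constant $c(k)$, depending only on $k$, such that for every integer $n\ge k+1$ and every symmetric convex body $K$ in $\mathbb{R}^n$ whose $k$-intersection body $I_k(K)$ exists and is convex, $$d_{BM}(I_k(K),B_2^n)\le c(k).$$
   Context: $B_2^n$ is the Euclidean unit ball of $\mathbb{R}^n$; a set $K$ is symmetric if $K=-K$; $|\cdot|$ denotes volume in the appropriate dimension. A compact set $K\subset\mathbb{R}^n$ is a star body if the origin is an interior point of $K$, every straight line through the origin crosses the boundary of $K$ at exactly two points, and the Minkowski functional $\|x\|_K=\min\{a\ge 0: x\in aK\}$ is continuous on $\mathbb{R}^n$. For $1\le k\le n-1$ and symmetric star bodies $K,D$ in $\mathbb{R}^n$, $D$ is the $k$-intersection body of $K$ if $|D\cap H^\perp|=|K\cap H|$ for every $(n-k)$-dimensional linear subspace $H$ of $\mathbb{R}^n$. Such a $D$ is unique if it exists (it need not exist for $k>1$), and is then denoted $I_k(K)$. The geometric distance $d_G(K_1,K_2)$ is the infimum of all $r>0$ for which there is $a>0$ with $K_1\subseteq aK_2\subseteq rK_1$. The Banach–Mazur distance is $d_{BM}(K_1,K_2)=\inf_{T\in GL_n}d_G(K_1,TK_2)$, where $GL_n$ is the set of invertible linear maps of $\mathbb{R}^n$. *)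

theory Defs
  imports "HOL-Analysis.Analysis" "HOL-Library.Function_Algebras"
begin

text \<open>
  The constant in the theorem is uniform in the dimension \<open>n\<close>, so all the spaces \<open>\<real>\<^sup>n\<close> have to be
  sets inside a single type: \<open>\<real>\<^sup>n\<close> is the set of all \<open>x :: nat \<Rightarrow> real\<close> that vanish outside
  \<open>{..<n}\<close>. With pointwise operations \<open>nat \<Rightarrow> real\<close> is a real vector space, so that the library's
  \<open>subspace\<close>, \<open>dim\<close>, \<open>linear\<close> and \<open>convex\<close> apply. Its library topology is the product topology,
  which induces the Euclidean topology on each \<open>\<real>\<^sup>n\<close>.
\<close>

instantiation "fun" :: (type, real_vector) real_vector
begin

definition scaleR_fun :: "real \<Rightarrow> ('a \<Rightarrow> 'b) \<Rightarrow> 'a \<Rightarrow> 'b"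
  where "scaleR_fun r f = (\<lambda>x. r *\<^sub>R f x)"

instance
  by standard (simp_all add: scaleR_fun_def fun_eq_iff scaleR_add_right scaleR_add_left)

end

definition Rn :: "nat \<Rightarrow> (nat \<Rightarrow> real) set"
  where "Rn n = {x. \<forall>i\<ge>n. x i = 0}"

definition dot :: "nat \<Rightarrow> (nat \<Rightarrow> real) \<Rightarrow> (nat \<Rightarrow> real) \<Rightarrow> real"
  where "dot n x y = (\<Sum>i<n. x i * y i)"

definition unit_ball :: "nat \<Rightarrow> (nat \<Rightarrow> real) set"
  where "unit_ball n = {x \<in> Rn n. sqrt (dot n x x) \<le> 1}"

definition orth_compl :: "nat \<Rightarrow> (nat \<Rightarrow> real) set \<Rightarrow> (nat \<Rightarrow> real) set"
  where "orth_compl n H = {x \<in> Rn n. \<forall>y\<in>H. dot n x y = 0}"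

definition orthonormal_basis :: "nat \<Rightarrow> (nat \<Rightarrow> real) set \<Rightarrow> (nat \<Rightarrow> (nat \<Rightarrow> real)) \<Rightarrow> bool"
  where "orthonormal_basis n E b \<longleftrightarrow>
    (\<forall>i<dim E. \<forall>j<dim E. dot n (b i) (b j) = (if i = j then 1 else 0)) \<and>
    span (b ` {..<dim E}) = E"

text \<open>
  The \<open>dim E\<close>-dimensional volume of the part of \<open>A\<close> in the subspace \<open>E\<close> of \<open>\<real>\<^sup>n\<close>: the Lebesgue
  measure of the set of coordinate vectors with respect to an orthonormal basis of \<open>E\<close>. By the
  orthogonal invariance of Lebesgue measure the choice of the basis is immaterial. Only compact
  sets are measured below, so Lebesgue measure on Borel sets suffices.
\<close>

definition sub_vol :: "nat \<Rightarrow> (nat \<Rightarrow> real) set \<Rightarrow> (nat \<Rightarrow> real) set \<Rightarrow> real"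
  where "sub_vol n E A =
    (let b = (SOME b. orthonormal_basis n E b) in
      measure (\<Pi>\<^sub>M i\<in>{..<dim E}. lborel)
        {c \<in> {..<dim E} \<rightarrow>\<^sub>E UNIV. (\<Sum>i<dim E. c i *\<^sub>R b i) \<in> A})"

definition symmetric :: "(nat \<Rightarrow> real) set \<Rightarrow> bool"
  where "symmetric K \<longleftrightarrow> uminus ` K = K"

definition convex_body :: "nat \<Rightarrow> (nat \<Rightarrow> real) set \<Rightarrow> bool"
  where "convex_body n K \<longleftrightarrow>
    K \<subseteq> Rn n \<and> compact K \<and> convex K \<and> top_of_set (Rn n) interior_of K \<noteq> {}"

definition minkowski :: "(nat \<Rightarrow> real) set \<Rightarrow> (nat \<Rightarrow> real) \<Rightarrow> real"
  where "minkowski K x = (LEAST a. 0 \<le> a \<and> x \<in> (\<lambda>y. a *\<^sub>R y) ` K)"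

definition star_body :: "nat \<Rightarrow> (nat \<Rightarrow> real) set \<Rightarrow> bool"
  where "star_body n K \<longleftrightarrow>
    K \<subseteq> Rn n \<and> compact K \<and> 0 \<in> top_of_set (Rn n) interior_of K \<and>
    (\<forall>x\<in>Rn n - {0}. card (range (\<lambda>t::real. t *\<^sub>R x) \<inter> (top_of_set (Rn n) frontier_of K)) = 2) \<and>
    continuous_on (Rn n) (minkowski K)"

text \<open>\<open>D\<close> is the \<open>k\<close>-intersection body \<open>I\<^sub>k(K)\<close> of \<open>K\<close> in \<open>\<real>\<^sup>n\<close>.\<close>

definition is_intersection_body ::
  "nat \<Rightarrow> nat \<Rightarrow> (nat \<Rightarrow> real) set \<Rightarrow> (nat \<Rightarrow> real) set \<Rightarrow> bool"
  where "is_intersection_body n k K D \<longleftrightarrow>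
    1 \<le> k \<and> k + 1 \<le> n \<and>
    star_body n K \<and> symmetric K \<and> star_body n D \<and> symmetric D \<and>
    (\<forall>H. subspace H \<and> H \<subseteq> Rn n \<and> dim H = n - k \<longrightarrow>
      sub_vol n (orth_compl n H) (D \<inter> orth_compl n H) = sub_vol n H (K \<inter> H))"

text \<open>
  The infima below are taken in the reals; they are infima of nonempty sets bounded below by 0
  whenever the arguments are compact subsets of \<open>\<real>\<^sup>n\<close> with the origin in their interior.
\<close>

definition geom_dist :: "(nat \<Rightarrow> real) set \<Rightarrow> (nat \<Rightarrow> real) set \<Rightarrow> real"
  where "geom_dist K1 K2 =
    Inf {r. 0 < r \<and> (\<exists>a>0. K1 \<subseteq> (\<lambda>x. a *\<^sub>R x) ` K2 \<and>
                            (\<lambda>x. a *\<^sub>R x) ` K2 \<subseteq> (\<lambda>x. r *\<^sub>R x) ` K1)}"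

text \<open>
  Every linear map on \<open>\<real>\<^sup>n\<close> extends to a linear map on the whole type, so the maps \<open>T\<close> below
  restrict to exactly the elements of \<open>GL\<^sub>n\<close>.
\<close>

definition GL :: "nat \<Rightarrow> ((nat \<Rightarrow> real) \<Rightarrow> nat \<Rightarrow> real) set"
  where "GL n = {T. linear T \<and> bij_betw T (Rn n) (Rn n)}"

definition banach_mazur_dist :: "nat \<Rightarrow> (nat \<Rightarrow> real) set \<Rightarrow> (nat \<Rightarrow> real) set \<Rightarrow> real"
  where "banach_mazur_dist n K1 K2 = (INF T\<in>GL n. geom_dist K1 (T ` K2))"

end

theory Submission
  imports Defs
begin

text \<open>
  Write \<open>k = m + 1\<close>, \<open>|A|\<close> for volumes, and \<open>a \<approx> b\<close> if the quotient of \<open>a\<close> and \<open>b\<close> is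
  bounded above and below by positive constants that depend on \<open>k\<close> only. The case \<open>k = 1\<close> is
  Hensley's theorem. If \<open>v\<close> is a unit vector, then \<open>t \<mapsto> |K \<inter> (v\<^sup>\<bottom> + t v)|\<close> is an even log-concave
  function on the line, by the Prekopa-Leindler inequality, and for such a function \<open>f\<close> the
  quantities \<open>f(0)\<^sup>2 \<integral> t\<^sup>2 f\<close> and \<open>(\<integral> f)\<^sup>3\<close> are comparable. Hence \<open>|K \<inter> v\<^sup>\<bottom>|\<close> is, up to absolute
  constants, \<open>|K|\<^sup>3\<^sup>/\<^sup>2\<close> divided by the square root of the quadratic form
  \<open>Q(v) = \<integral>\<^sub>K \<langle>x, v\<rangle>\<^sup>2 dx\<close>, whatever the dimension.

  For larger \<open>k\<close>, fix an \<open>m\<close>-dimensional subspace \<open>F\<close> and let \<open>v\<close> run through the unit vectors of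
  \<open>F\<^sup>\<bottom>\<close>. Apply the above to the body \<open>K \<inter> F\<^sup>\<bottom>\<close>, whose central section \<open>K \<inter> (F + \<real> v)\<^sup>\<bottom>\<close> has the
  volume of \<open>D \<inter> (F + \<real> v)\<close>. Since \<open>D\<close> is convex, this last volume is \<open>\<approx> |D \<inter> F| w(v)\<close>, where
  \<open>w(v)\<close> is the radius in the direction \<open>v\<close> of the orthogonal projection of \<open>D\<close> to \<open>F\<^sup>\<bottom>\<close>
  (\<open>vol_cone_lower\<close>, \<open>vol_slab_upper\<close>). So this projection is within a factor depending on \<open>k\<close> of
  an ellipsoid \<open>Q \<le> const\<close>, where now \<open>Q(v) = \<integral> \<langle>x, v\<rangle>\<^sup>2 dx\<close> over \<open>K \<inter> F\<^sup>\<bottom>\<close>.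

  It remains to choose \<open>F\<close> so that \<open>D\<close> is close to a sum of its projections to \<open>F\<close> and to
  \<open>F\<^sup>\<bottom>\<close>. A greedy choice works: \<open>F\<close> is spanned by directions \<open>u\<^sub>0, \<dots>, u\<^sub>m\<^sub>-\<^sub>1\<close>, where \<open>R\<^sub>i u\<^sub>i\<close> is a
  point of \<open>D\<close> orthogonal to \<open>u\<^sub>0, \<dots>, u\<^sub>i\<^sub>-\<^sub>1\<close> and farthest from the origin (\<open>greedy_frame_exists\<close>). Then
  \<open>|\<langle>x, u\<^sub>i\<rangle>| \<le> 2\<^sup>i R\<^sub>i\<close> on \<open>D\<close>, and the projection of \<open>D\<close> to \<open>F\<^sup>\<bottom>\<close> lies in \<open>2\<^sup>m D\<close>.
  Together with the estimates of the projection (\<open>projection_upper\<close>, \<open>projection_lower\<close>) this shows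
  that \<open>D\<close> is within a factor depending on \<open>k\<close> of the ellipsoid
  \<open>\<Sum>\<^sub>i \<langle>x, u\<^sub>i\<rangle>\<^sup>2 / R\<^sub>i\<^sup>2 + \<lambda> Q(x) \<le> 1\<close> with \<open>\<lambda> = |D \<inter> F|\<^sup>2 / |K \<inter> F\<^sup>\<bottom>|\<^sup>3\<close>.

  Volumes in subspaces are handled by \<open>frame_measure\<close>, the image of Lebesgue measure under the
  coordinates of an orthonormal system. It satisfies Fubini's theorem with respect to the last
  vector of the system, and it depends on the span only (\<open>frame_measure_unique\<close>).
\<close>

section \<open>Orthonormal systems\<close>

text \<open>
  Vectors are functions here. Evaluating their sums pointwise would break up the vector identities
  that the proofs work with.
\<close>

declare plus_fun_apply [simp del] zero_fun_apply [simp del]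

lemmas fun_vec_simps = plus_fun_apply zero_fun_apply scaleR_fun_def

lemma sum_fun_app: "(\<Sum>i\<in>A. f i) x = (\<Sum>i\<in>A. (f i x :: real))"
  by (induction A rule: infinite_finite_induct) (auto simp: fun_vec_simps)

lemma subspace_Rn: "subspace (Rn n)"
  by (auto simp: subspace_def Rn_def fun_vec_simps)

lemma comb_in_span:
  fixes b :: "nat \<Rightarrow> nat \<Rightarrow> real"
  shows "(\<Sum>i<d. c i *\<^sub>R b i) \<in> span (b ` {..<d})"
  by (intro span_sum span_scale span_base) auto

definition axis_vec :: "nat \<Rightarrow> nat \<Rightarrow> real"
  where "axis_vec i = (\<lambda>j. if j = i then 1 else 0)"

lemma Rn_expand:
  assumes "x \<in> Rn n"
  shows "x = (\<Sum>i<n. x i *\<^sub>R axis_vec i)"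
proof
  fix j
  have "(\<Sum>i<n. x i *\<^sub>R axis_vec i) j = (\<Sum>i<n. if i = j then x j else 0)"
    unfolding sum_fun_app by (rule sum.cong) (auto simp: axis_vec_def scaleR_fun_def)
  also have "\<dots> = x j"
    using assms by (auto simp: Rn_def)
  finally show "x j = (\<Sum>i<n. x i *\<^sub>R axis_vec i) j" ..
qed

lemma Rn_subset_span_axis: "Rn n \<subseteq> span (axis_vec ` {..<n})"
proof
  fix x assume "x \<in> Rn n"
  have "(\<Sum>i<n. x i *\<^sub>R axis_vec i) \<in> span (axis_vec ` {..<n})"
    by (rule comb_in_span)
  with Rn_expand[OF \<open>x \<in> Rn n\<close>] show "x \<in> span (axis_vec ` {..<n})" by simp
qed

definition orthonormal_seq :: "((nat \<Rightarrow> real) \<Rightarrow> (nat \<Rightarrow> real) \<Rightarrow> real) \<Rightarrow> nat \<Rightarrow> (nat \<Rightarrow> nat \<Rightarrow> real) \<Rightarrow> bool"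
  where "orthonormal_seq B d b \<longleftrightarrow> (\<forall>i<d. \<forall>j<d. B (b i) (b j) = (if i = j then 1 else 0))"

lemma orthonormal_seqD:
  "orthonormal_seq B d b \<Longrightarrow> i < d \<Longrightarrow> j < d \<Longrightarrow> B (b i) (b j) = (if i = j then 1 else 0)"
  by (auto simp: orthonormal_seq_def)

lemma orthonormal_seq_mono: "orthonormal_seq B d b \<Longrightarrow> e \<le> d \<Longrightarrow> orthonormal_seq B e b"
  by (auto simp: orthonormal_seq_def)

locale inner_form =
  fixes n :: nat and B :: "(nat \<Rightarrow> real) \<Rightarrow> (nat \<Rightarrow> real) \<Rightarrow> real"
  assumes add_left: "B (x + y) z = B x z + B y z"
    and scale_left: "B (r *\<^sub>R x) z = r * B x z"
    and sym: "B x y = B y x"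
    and pos: "x \<in> Rn n \<Longrightarrow> x \<noteq> 0 \<Longrightarrow> 0 < B x x"

lemma inner_form_dot: "inner_form n (dot n)"
proof
  fix x :: "nat \<Rightarrow> real" assume x: "x \<in> Rn n" "x \<noteq> 0"
  then obtain j where j: "x j \<noteq> 0" by (auto simp: fun_eq_iff zero_fun_apply)
  then have "j < n" using x(1) unfolding Rn_def mem_Collect_eq by (meson not_le_imp_less)
  then show "0 < dot n x x" unfolding dot_def
    using j by (intro sum_pos2[of _ j]) (auto simp: zero_less_mult_iff)
qed (auto simp: dot_def fun_vec_simps algebra_simps sum.distrib sum_distrib_left)

context inner_form
begin

lemma add_right: "B z (x + y) = B z x + B z y"
  using add_left sym by metis

lemma scale_right: "B z (r *\<^sub>R x) = r * B z x"
  using scale_left sym by metis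

lemma zero_left [simp]: "B 0 x = 0" and zero_right [simp]: "B x 0 = 0"
  using scale_left[of 0 0 x] scale_right[of x 0 0] by auto

lemma diff_left: "B (x - y) z = B x z - B y z"
  using add_left[of "x - y" y z] by simp

lemma diff_right: "B z (x - y) = B z x - B z y"
  using diff_left sym by metis

lemma sum_left: "B (\<Sum>i\<in>A. f i) z = (\<Sum>i\<in>A. B (f i) z)"
  by (induction A rule: infinite_finite_induct) (auto simp: add_left)

lemma comb_right:
  assumes "orthonormal_seq B d b" "j < d"
  shows "B (\<Sum>i<d. c i *\<^sub>R b i) (b j) = c j"
proof -
  have "B (\<Sum>i<d. c i *\<^sub>R b i) (b j) = (\<Sum>i<d. if i = j then c j else 0)"
    unfolding sum_left scale_left
    by (rule sum.cong) (auto simp: orthonormal_seqD[OF assms(1)] assms)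
  also have "\<dots> = c j" using assms by simp
  finally show ?thesis .
qed

lemma comb_self:
  assumes "orthonormal_seq B d b"
  shows "B (\<Sum>i<d. c i *\<^sub>R b i) (\<Sum>i<d. c i *\<^sub>R b i) = (\<Sum>i<d. (c i)\<^sup>2)"
proof -
  let ?s = "\<Sum>i<d. c i *\<^sub>R b i"
  have "B ?s ?s = (\<Sum>i<d. c i * B (b i) ?s)"
    by (subst sum_left) (simp add: scale_left)
  also have "\<dots> = (\<Sum>i<d. (c i)\<^sup>2)"
    using comb_right[OF assms, of _ c] by (intro sum.cong) (auto simp: sym[of _ ?s] power2_eq_square)
  finally show ?thesis .
qed

lemma orthonormal_inj: "orthonormal_seq B d b \<Longrightarrow> inj_on b {..<d}"
  by (rule inj_onI) (metis lessThan_iff orthonormal_seqD zero_neq_one)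

lemma span_comb:
  assumes "orthonormal_seq B d b" "x \<in> span (b ` {..<d})"
  shows "x = (\<Sum>i<d. B x (b i) *\<^sub>R b i)"
  using assms(2)
proof (induction rule: span_induct_alt)
  case base
  then show ?case by simp
next
  case (step c y z)
  then obtain j where j: "j < d" "y = b j" by auto
  have "(\<Sum>i<d. B y (b i) *\<^sub>R b i) = (\<Sum>i<d. if i = j then b j else 0)"
    by (rule sum.cong) (auto simp: j orthonormal_seqD[OF assms(1)])
  also have "\<dots> = y" using j by simp
  finally have y: "(\<Sum>i<d. B y (b i) *\<^sub>R b i) = y" .
  have "(\<Sum>i<d. B (c *\<^sub>R y + z) (b i) *\<^sub>R b i)
      = c *\<^sub>R (\<Sum>i<d. B y (b i) *\<^sub>R b i) + (\<Sum>i<d. B z (b i) *\<^sub>R b i)"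
    by (simp add: add_left scale_left scaleR_add_left sum.distrib scaleR_sum_right)
  then show ?case using y step by simp
qed

lemma orthonormal_independent:
  assumes "orthonormal_seq B d b"
  shows "independent (b ` {..<d})"
proof (rule independent_if_scalars_zero)
  fix f x assume s: "(\<Sum>x\<in>b ` {..<d}. f x *\<^sub>R x) = 0" and "x \<in> b ` {..<d}"
  then obtain j where j: "j < d" "x = b j" by auto
  have "(\<Sum>i<d. f (b i) *\<^sub>R b i) = 0"
    using s by (subst (asm) sum.reindex[OF orthonormal_inj[OF assms]]) simp
  then have "B (\<Sum>i<d. f (b i) *\<^sub>R b i) (b j) = 0" by simp
  with comb_right[OF assms j(1), of "\<lambda>i. f (b i)"] j show "f x = 0" by simp
qed simp

lemma orthonormal_dim: 
  assumes "orthonormal_seq B d b"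
  shows "dim (span (b ` {..<d})) = d"
proof -
  have "dim (span (b ` {..<d})) = card (b ` {..<d})"
    using orthonormal_independent[OF assms] by (simp add: dim_span dim_eq_card_independent)
  then show ?thesis by (simp add: card_image[OF orthonormal_inj[OF assms]])
qed

lemma orthonormal_le:
  assumes "orthonormal_seq B d b" "b ` {..<d} \<subseteq> Rn n"
  shows "d \<le> n"
proof -
  have "card (b ` {..<d}) \<le> card (axis_vec ` {..<n})"
    using independent_span_bound[of "axis_vec ` {..<n}" "b ` {..<d}"]
      orthonormal_independent[OF assms(1)] assms(2) Rn_subset_span_axis[of n] by auto
  also have "\<dots> \<le> n" using card_image_le[of "{..<n}" axis_vec] by simp
  finally show ?thesis by (simp add: card_image[OF orthonormal_inj[OF assms(1)]])
qed

text \<open>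
  One step of the Gram-Schmidt process, for any form that is positive definite on \<open>\<real>\<^sup>n\<close>. Below it is
  used for the standard scalar product and for the form that defines the final ellipsoid.
\<close>

lemma orthonormal_step:
  assumes "orthonormal_seq B d b" "b ` {..<d} \<subseteq> Rn n" "x \<in> Rn n" "x \<notin> span (b ` {..<d})"
  obtains v where "v \<in> Rn n" "orthonormal_seq B (Suc d) (b(d := v))"
proof -
  define y where "y = x - (\<Sum>i<d. B x (b i) *\<^sub>R b i)"
  have yR: "y \<in> Rn n" unfolding y_def
    by (intro subspace_diff subspace_sum subspace_scale subspace_Rn assms) (use assms in auto)
  have "y \<noteq> 0"
    using assms(4) comb_in_span[of "\<lambda>i. B x (b i)" b d] by (auto simp: y_def)
  then have p: "B y y > 0" using pos yR by auto
  have yb: "B y (b i) = 0" if "i < d" for i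
    using comb_right[OF assms(1) that] by (simp add: y_def diff_left)
  define v where "v = (1 / sqrt (B y y)) *\<^sub>R y"
  have "v \<in> Rn n" unfolding v_def by (intro subspace_scale subspace_Rn yR)
  moreover have "B v v = 1"
    using p by (simp add: v_def scale_left scale_right)
  moreover have "B v (b i) = 0" "B (b i) v = 0" if "i < d" for i
    using yb[OF that] by (simp_all add: v_def scale_left sym[of "b i"])
  ultimately have "orthonormal_seq B (Suc d) (b(d := v))"
    using assms(1) by (auto simp: orthonormal_seq_def less_Suc_eq)
  with \<open>v \<in> Rn n\<close> show ?thesis using that by blast
qed

lemma orthonormal_span_Rn:
  assumes "orthonormal_seq B n b" "b ` {..<n} \<subseteq> Rn n"
  shows "span (b ` {..<n}) = Rn n"
proof
  show "span (b ` {..<n}) \<subseteq> Rn n" using assms subspace_Rn span_minimal by blast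
  show "Rn n \<subseteq> span (b ` {..<n})"
  proof
    fix x assume x: "x \<in> Rn n"
    show "x \<in> span (b ` {..<n})"
    proof (rule ccontr)
      assume "x \<notin> span (b ` {..<n})"
      then obtain v where v: "v \<in> Rn n" "orthonormal_seq B (Suc n) (b(n := v))"
        using orthonormal_step[OF assms x] by metis
      have "(b(n := v)) ` {..<Suc n} \<subseteq> Rn n" using v assms by auto
      from orthonormal_le[OF v(2) this] show False by simp
    qed
  qed
qed

lemma orthonormal_complete:
  assumes "orthonormal_seq B d b" "b ` {..<d} \<subseteq> Rn n"
  obtains w where "\<And>i. i < d \<Longrightarrow> w i = b i" "orthonormal_seq B n w" "w ` {..<n} \<subseteq> Rn n"
proof -
  have "d \<le> n" by (rule orthonormal_le[OF assms])
  have "\<exists>w. (\<forall>i<d. w i = b i) \<and> orthonormal_seq B (d + e) w \<and> w ` {..<d+e} \<subseteq> Rn n" if "d + e \<le> n" for e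
    using that
  proof (induction e)
    case 0
    then show ?case using assms by auto
  next
    case (Suc e)
    then obtain w where w: "\<forall>i<d. w i = b i" "orthonormal_seq B (d + e) w" "w ` {..<d+e} \<subseteq> Rn n"
      by auto
    have "\<not> Rn n \<subseteq> span (w ` {..<d+e})"
    proof
      assume a: "Rn n \<subseteq> span (w ` {..<d+e})"
      have i: "orthonormal_seq (dot n) n axis_vec"
        by (auto simp: orthonormal_seq_def dot_def axis_vec_def if_distrib[of "\<lambda>t. t * _"] cong: if_cong)
      interpret D: inner_form n "dot n" by (rule inner_form_dot)
      have "axis_vec ` {..<n} \<subseteq> Rn n" by (auto simp: Rn_def axis_vec_def)
      with a independent_span_bound[of "w ` {..<d+e}" "axis_vec ` {..<n}"] D.orthonormal_independent[OF i]
      have "card (axis_vec ` {..<n}) \<le> card (w ` {..<d+e})" by auto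
      moreover have "card (w ` {..<d+e}) \<le> d + e" using card_image_le[of "{..<d+e}" w] by simp
      ultimately show False using Suc.prems card_image[OF D.orthonormal_inj[OF i]] by simp
    qed
    then obtain x where "x \<in> Rn n" "x \<notin> span (w ` {..<d+e})" by auto
    from orthonormal_step[OF w(2,3) this] obtain v where
      v: "v \<in> Rn n" "orthonormal_seq B (Suc (d + e)) (w(d + e := v))" .
    have "(w(d + e := v)) ` {..<d + Suc e} \<subseteq> Rn n" "\<forall>i<d. (w(d + e := v)) i = b i"
      using w(1,3) v(1) by (auto simp: less_Suc_eq image_subset_iff)
    moreover have "orthonormal_seq B (d + Suc e) (w(d + e := v))"
      using v(2) by (simp only: add_Suc_right)
    ultimately show ?case by blast
  qed
  from this[of "n - d"] \<open>d \<le> n\<close> show ?thesis using that by auto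
qed

end

section \<open>Lebesgue measure on subspaces\<close>

lemma measurable_to_fun:
  "(\<And>i. (\<lambda>x. f x i) \<in> borel_measurable M) \<Longrightarrow> (f :: _ \<Rightarrow> nat \<Rightarrow> real) \<in> borel_measurable M"
  by (rule measurable_coordinatewise_then_product) auto

lemma borel_measurable_fun_add [measurable (raw)]:
  fixes f g :: "_ \<Rightarrow> nat \<Rightarrow> real"
  assumes [measurable]: "f \<in> borel_measurable M" "g \<in> borel_measurable M"
  shows "(\<lambda>x. f x + g x) \<in> borel_measurable M"
proof (rule measurable_to_fun)
  fix i
  have [measurable]: "(\<lambda>x. f x i) \<in> borel_measurable M" "(\<lambda>x. g x i) \<in> borel_measurable M"
    using assms[THEN measurable_product_then_coordinatewise] by auto
  show "(\<lambda>x. (f x + g x) i) \<in> borel_measurable M" unfolding plus_fun_apply by measurable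
qed

lemma borel_measurable_fun_scaleR [measurable (raw)]:
  fixes g :: "_ \<Rightarrow> nat \<Rightarrow> real"
  assumes [measurable]: "f \<in> borel_measurable M" "g \<in> borel_measurable M"
  shows "(\<lambda>x. f x *\<^sub>R g x) \<in> borel_measurable M"
proof (rule measurable_to_fun)
  fix i
  have [measurable]: "(\<lambda>x. g x i) \<in> borel_measurable M"
    using assms(2)[THEN measurable_product_then_coordinatewise] by auto
  show "(\<lambda>x. (f x *\<^sub>R g x) i) \<in> borel_measurable M" unfolding scaleR_fun_def by measurable
qed

lemma borel_measurable_fun_diff [measurable (raw)]:
  fixes f g :: "_ \<Rightarrow> nat \<Rightarrow> real"
  assumes [measurable]: "f \<in> borel_measurable M" "g \<in> borel_measurable M"
  shows "(\<lambda>x. f x - g x) \<in> borel_measurable M"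
proof -
  have "(\<lambda>x. f x + (-1) *\<^sub>R g x) \<in> borel_measurable M" by measurable
  then show ?thesis by simp
qed

lemma borel_measurable_dot [measurable (raw)]:
  fixes f g :: "_ \<Rightarrow> nat \<Rightarrow> real"
  assumes [measurable]: "f \<in> borel_measurable M" "g \<in> borel_measurable M"
  shows "(\<lambda>x. dot n (f x) (g x)) \<in> borel_measurable M"
proof -
  have [measurable]: "(\<lambda>x. f x i) \<in> borel_measurable M" "(\<lambda>x. g x i) \<in> borel_measurable M" for i
    using assms[THEN measurable_product_then_coordinatewise] by auto
  show ?thesis unfolding dot_def by measurable
qed

abbreviation coord_measure :: "nat \<Rightarrow> (nat \<Rightarrow> real) measure"
  where "coord_measure d \<equiv> Pi\<^sub>M {..<d} (\<lambda>_. lborel)"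

lemma measurable_comb [measurable]:
  "(\<lambda>c. \<Sum>i<d. c i *\<^sub>R b i) \<in> coord_measure d \<rightarrow>\<^sub>M (borel :: (nat \<Rightarrow> real) measure)"
proof (rule measurable_to_fun)
  fix j
  show "(\<lambda>c. (\<Sum>i<d. c i *\<^sub>R b i) j) \<in> borel_measurable (coord_measure d)"
    unfolding sum_fun_app scaleR_fun_def by measurable
qed

text \<open>
  Lebesgue measure on the span of an orthonormal system, as a measure on the whole type. Keeping
  the ambient space fixed makes measures that come from different bases of one subspace comparable.
\<close>

definition frame_measure :: "nat \<Rightarrow> (nat \<Rightarrow> nat \<Rightarrow> real) \<Rightarrow> (nat \<Rightarrow> real) measure"
  where "frame_measure d b = distr (coord_measure d) borel (\<lambda>c. \<Sum>i<d. c i *\<^sub>R b i)"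

lemma sets_frame [simp, measurable_cong]: "sets (frame_measure d b) = sets borel"
  and space_frame [simp]: "space (frame_measure d b) = UNIV"
  by (auto simp: frame_measure_def)

lemma frame_cong: "(\<And>i. i < d \<Longrightarrow> b i = b' i) \<Longrightarrow> frame_measure d b = frame_measure d b'"
  unfolding frame_measure_def by (intro distr_cong) auto

lemma nn_integral_frame:
  assumes [measurable]: "f \<in> borel_measurable borel"
  shows "(\<integral>\<^sup>+x. f x \<partial>frame_measure d b) = (\<integral>\<^sup>+c. f (\<Sum>i<d. c i *\<^sub>R b i) \<partial>coord_measure d)"
  unfolding frame_measure_def by (subst nn_integral_distr) auto

interpretation lborel_product: product_sigma_finite "\<lambda>_::nat. lborel :: real measure"
  by standard

lemma sigma_finite_coord: "sigma_finite_measure (coord_measure d)"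
  by (rule lborel_product.sigma_finite) simp

lemma nn_integral_frame_0:
  assumes "f \<in> borel_measurable borel"
  shows "(\<integral>\<^sup>+x. f x \<partial>frame_measure 0 b) = f 0"
  using assms by (simp add: nn_integral_frame PiM_empty nn_integral_count_space_finite)

text \<open>
  Fubini's theorem for the last vector of the system. It reduces the behaviour under translations
  and dilations to that of Lebesgue measure on the line, by induction on \<open>d\<close>.
\<close>

lemma nn_integral_frame_Suc:
  assumes [measurable]: "f \<in> borel_measurable borel"
  shows "(\<integral>\<^sup>+x. f x \<partial>frame_measure (Suc d) b)
    = (\<integral>\<^sup>+t. (\<integral>\<^sup>+x. f (x + t *\<^sub>R b d) \<partial>frame_measure d b) \<partial>lborel)"
proof -
  have "(\<integral>\<^sup>+x. f x \<partial>frame_measure (Suc d) b)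
      = (\<integral>\<^sup>+c. f (\<Sum>i<Suc d. c i *\<^sub>R b i) \<partial>Pi\<^sub>M (insert d {..<d}) (\<lambda>_. lborel))"
    by (subst nn_integral_frame) (auto simp: lessThan_Suc)
  also have "\<dots> = (\<integral>\<^sup>+t. (\<integral>\<^sup>+c. f (\<Sum>i<Suc d. (c(d := t)) i *\<^sub>R b i) \<partial>coord_measure d) \<partial>lborel)"
  proof (rule lborel_product.product_nn_integral_insert_rev)
    have "(\<lambda>c. f (\<Sum>i<Suc d. c i *\<^sub>R b i)) \<in> borel_measurable (coord_measure (Suc d))"
      by measurable
    then show "(\<lambda>c. f (\<Sum>i<Suc d. c i *\<^sub>R b i)) \<in> borel_measurable (Pi\<^sub>M (insert d {..<d}) (\<lambda>_. lborel))"
      by (simp add: lessThan_Suc)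
  qed auto
  also have "\<dots> = (\<integral>\<^sup>+t. (\<integral>\<^sup>+c. f ((\<Sum>i<d. c i *\<^sub>R b i) + t *\<^sub>R b d) \<partial>coord_measure d) \<partial>lborel)"
    by (intro nn_integral_cong arg_cong[of _ _ f]) (auto intro!: sum.cong)
  also have "\<dots> = (\<integral>\<^sup>+t. (\<integral>\<^sup>+x. f (x + t *\<^sub>R b d) \<partial>frame_measure d b) \<partial>lborel)"
    by (intro nn_integral_cong) (subst nn_integral_frame; measurable)
  finally show ?thesis .
qed

lemma nn_integral_frame_cong:
  assumes "f \<in> borel_measurable borel" "g \<in> borel_measurable borel"
    and "\<And>x. x \<in> span (b ` {..<d}) \<Longrightarrow> f x = g x"
  shows "(\<integral>\<^sup>+x. f x \<partial>frame_measure d b) = (\<integral>\<^sup>+x. g x \<partial>frame_measure d b)"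
  unfolding nn_integral_frame[OF assms(1)] nn_integral_frame[OF assms(2)]
  by (intro nn_integral_cong assms(3) comb_in_span)

lemma measurable_frame_section:
  assumes [measurable]: "f \<in> borel_measurable (borel :: (nat \<Rightarrow> real) measure)"
  shows "(\<lambda>t. \<integral>\<^sup>+x. f (x + t *\<^sub>R v) \<partial>frame_measure d b) \<in> borel_measurable (borel :: real measure)"
proof -
  interpret sigma_finite_measure "coord_measure d" by (rule sigma_finite_coord)
  show ?thesis by (subst nn_integral_frame; measurable)
qed

lemma nn_integral_frame_translate_comb:
  assumes "f \<in> borel_measurable borel"
  shows "(\<integral>\<^sup>+x. f (x + (\<Sum>i<d. c i *\<^sub>R b i)) \<partial>frame_measure d b) = (\<integral>\<^sup>+x. f x \<partial>frame_measure d b)"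
  using assms
proof (induction d arbitrary: f)
  case 0
  then show ?case by simp
next
  case (Suc d)
  note [measurable] = Suc.prems
  let ?y = "\<Sum>i<d. c i *\<^sub>R b i"
  have "(\<integral>\<^sup>+x. f (x + (\<Sum>i<Suc d. c i *\<^sub>R b i)) \<partial>frame_measure (Suc d) b)
      = (\<integral>\<^sup>+t. (\<integral>\<^sup>+x. f ((x + ?y) + (c d + 1 * t) *\<^sub>R b d) \<partial>frame_measure d b) \<partial>lborel)"
    by (subst nn_integral_frame_Suc) (auto simp: algebra_simps)
  also have "\<dots> = (\<integral>\<^sup>+t. (\<integral>\<^sup>+x. f (x + (c d + 1 * t) *\<^sub>R b d) \<partial>frame_measure d b) \<partial>lborel)"
    by (intro nn_integral_cong Suc.IH[of "\<lambda>x. f (x + _)"]) measurable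
  also have "\<dots> = (\<integral>\<^sup>+t. (\<integral>\<^sup>+x. f (x + t *\<^sub>R b d) \<partial>frame_measure d b) \<partial>lborel)"
    by (subst (2) nn_integral_real_affine[of _ 1 "c d"]) (auto intro!: measurable_frame_section)
  also have "\<dots> = (\<integral>\<^sup>+x. f x \<partial>frame_measure (Suc d) b)"
    by (subst nn_integral_frame_Suc) auto
  finally show ?case .
qed

lemma nn_integral_frame_scale:
  assumes "f \<in> borel_measurable borel" "s \<noteq> 0"
  shows "(\<integral>\<^sup>+x. f x \<partial>frame_measure d b) = ennreal (\<bar>s\<bar> ^ d) * (\<integral>\<^sup>+x. f (s *\<^sub>R x) \<partial>frame_measure d b)"
  using assms(1)
proof (induction d arbitrary: f)
  case 0
  then have [measurable]: "f \<in> borel_measurable borel" .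
  show ?case by (simp add: nn_integral_frame_0)
next
  case (Suc d)
  note [measurable] = Suc.prems
  have "(\<integral>\<^sup>+x. f x \<partial>frame_measure (Suc d) b)
      = (\<integral>\<^sup>+t. (\<integral>\<^sup>+x. f (x + t *\<^sub>R b d) \<partial>frame_measure d b) \<partial>lborel)"
    by (subst nn_integral_frame_Suc) auto
  also have "\<dots> = (\<integral>\<^sup>+t. ennreal (\<bar>s\<bar> ^ d) * (\<integral>\<^sup>+x. f (s *\<^sub>R x + t *\<^sub>R b d) \<partial>frame_measure d b) \<partial>lborel)"
    by (intro nn_integral_cong Suc.IH[of "\<lambda>x. f (x + _)"]) measurable
  also have "\<dots> = ennreal (\<bar>s\<bar> ^ d) * (\<integral>\<^sup>+t. (\<integral>\<^sup>+x. f (s *\<^sub>R x + t *\<^sub>R b d) \<partial>frame_measure d b) \<partial>lborel)"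
    using measurable_frame_section[where f = "\<lambda>x. f (s *\<^sub>R x)" and v = "(1/s) *\<^sub>R b d" and d = d and b = b] assms(2)
    by (subst nn_integral_cmult) (auto simp: scaleR_add_right)
  also have "(\<integral>\<^sup>+t. (\<integral>\<^sup>+x. f (s *\<^sub>R x + t *\<^sub>R b d) \<partial>frame_measure d b) \<partial>lborel)
      = ennreal \<bar>s\<bar> * (\<integral>\<^sup>+t. (\<integral>\<^sup>+x. f (s *\<^sub>R x + (0 + s * t) *\<^sub>R b d) \<partial>frame_measure d b) \<partial>lborel)"
    using measurable_frame_section[where f = "\<lambda>x. f (s *\<^sub>R x)" and v = "(1/s) *\<^sub>R b d" and d = d and b = b] assms(2)
    by (intro nn_integral_real_affine) (auto simp: scaleR_add_right)
  also have "(\<integral>\<^sup>+t. (\<integral>\<^sup>+x. f (s *\<^sub>R x + (0 + s * t) *\<^sub>R b d) \<partial>frame_measure d b) \<partial>lborel)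
      = (\<integral>\<^sup>+x. f (s *\<^sub>R x) \<partial>frame_measure (Suc d) b)"
    by (subst nn_integral_frame_Suc) (auto simp: scaleR_add_right)
  finally show ?case by (simp add: mult.assoc[symmetric] ennreal_mult[symmetric] mult.commute)
qed

text \<open>
  The right-hand side does not depend on \<open>b\<close>: this is what fixes the constant in the uniqueness
  result below.
\<close>

lemma frame_ball:
  assumes "orthonormal_seq (dot n) d b"
  shows "emeasure (frame_measure d b) {x. dot n x x \<le> r}
    = emeasure (coord_measure d) {c \<in> space (coord_measure d). (\<Sum>i<d. (c i)\<^sup>2) \<le> r}"
proof -
  interpret inner_form n "dot n" by (rule inner_form_dot)
  have "{x. dot n x x \<le> r} \<in> sets borel" by measurable
  then show ?thesis unfolding frame_measure_def
    by (subst emeasure_distr) (auto intro!: arg_cong2[of _ _ _ _ emeasure] simp: comb_self[OF assms])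
qed

lemma frame_ball_finite:
  assumes "orthonormal_seq (dot n) d b"
  shows "emeasure (frame_measure d b) {x. dot n x x \<le> r} < \<infinity>"
proof -
  define R where "R = \<bar>r\<bar> + 1"
  have R: "R > 0" "r \<le> R\<^sup>2" unfolding R_def by (auto simp: power2_eq_square algebra_simps intro: order_trans[OF abs_ge_self])
  have "{c \<in> space (coord_measure d). (\<Sum>i<d. (c i)\<^sup>2) \<le> r} \<subseteq> {..<d} \<rightarrow>\<^sub>E {-R..R}"
  proof (rule subsetI)
    fix c assume "c \<in> {c \<in> space (coord_measure d). (\<Sum>i<d. (c i)\<^sup>2) \<le> r}"
    then have c: "c \<in> space (coord_measure d)" "(\<Sum>i<d. (c i)\<^sup>2) \<le> r" by auto
    have "c i \<in> {-R..R}" if "i < d" for i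
    proof -
      have "(c i)\<^sup>2 \<le> (\<Sum>i<d. (c i)\<^sup>2)" using that by (intro member_le_sum) auto
      then have "(c i)\<^sup>2 \<le> R\<^sup>2" using c R by simp
      then have "\<bar>c i\<bar> \<le> R" using R by (simp add: abs_le_square_iff[symmetric])
      then show ?thesis by auto
    qed
    then show "c \<in> {..<d} \<rightarrow>\<^sub>E {-R..R}" using c by (auto simp: space_PiM PiE_def)
  qed
  then have "emeasure (frame_measure d b) {x. dot n x x \<le> r} \<le> emeasure (coord_measure d) ({..<d} \<rightarrow>\<^sub>E {-R..R})"
    unfolding frame_ball[OF assms] by (intro emeasure_mono) auto
  also have "\<dots> = (\<Prod>i<d. ennreal (2 * R))"
    using R by (subst lborel_product.emeasure_PiM) (auto simp: )
  also have "\<dots> < \<infinity>" using R by (simp add: ennreal_power less_top[symmetric])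
  finally show ?thesis .
qed

lemma frame_ball_positive:
  assumes "orthonormal_seq (dot n) d b" "r > 0"
  shows "emeasure (frame_measure d b) {x. dot n x x \<le> r} > 0"
proof -
  define s where "s = sqrt (r / (real d + 1))"
  have s: "s > 0" "s\<^sup>2 = r / (real d + 1)" using assms by (auto simp: s_def)
  have "{..<d} \<rightarrow>\<^sub>E {-s..s} \<subseteq> {c \<in> space (coord_measure d). (\<Sum>i<d. (c i)\<^sup>2) \<le> r}"
  proof safe
    fix c assume c: "c \<in> {..<d} \<rightarrow>\<^sub>E {-s..s}"
    then show "c \<in> space (coord_measure d)" by (auto simp: space_PiM PiE_def)
    have "(c i)\<^sup>2 \<le> s\<^sup>2" if "i < d" for i
      using c that by (intro abs_le_square_iff[THEN iffD1]) (force simp: PiE_def Pi_def)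
    then have "(\<Sum>i<d. (c i)\<^sup>2) \<le> (\<Sum>i<d. s\<^sup>2)" by (intro sum_mono) auto
    also have "\<dots> \<le> r" using assms by (simp add: s divide_simps)
    finally show "(\<Sum>i<d. (c i)\<^sup>2) \<le> r" .
  qed
  moreover have "{c \<in> space (coord_measure d). (\<Sum>i<d. (c i)\<^sup>2) \<le> r} \<in> sets (coord_measure d)"
    by measurable
  ultimately have "emeasure (coord_measure d) ({..<d} \<rightarrow>\<^sub>E {-s..s}) \<le> emeasure (frame_measure d b) {x. dot n x x \<le> r}"
    unfolding frame_ball[OF assms(1)] by (intro emeasure_mono) auto
  moreover have "emeasure (coord_measure d) ({..<d} \<rightarrow>\<^sub>E {-s..s}) = (\<Prod>i<d. ennreal (2 * s))"
    using s by (subst lborel_product.emeasure_PiM) auto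
  moreover have "(\<Prod>i<d. ennreal (2 * s)) > 0" using s by (simp add: ennreal_power)
  ultimately show ?thesis by simp
qed

lemma sigma_finite_frame:
  assumes "orthonormal_seq (dot n) d b"
  shows "sigma_finite_measure (frame_measure d b)"
proof
  let ?A = "range (\<lambda>k::nat. {x. dot n x x \<le> real k})"
  have "countable ?A" by simp
  moreover have "?A \<subseteq> sets (frame_measure d b)" by auto
  moreover have "\<Union> ?A = space (frame_measure d b)" using real_arch_simple by auto
  moreover have "\<forall>a\<in>?A. emeasure (frame_measure d b) a \<noteq> \<infinity>"
    using frame_ball_finite[OF assms] by (auto simp: less_top)
  ultimately show "\<exists>A. countable A \<and> A \<subseteq> sets (frame_measure d b) \<and> \<Union> A = space (frame_measure d b) \<and>
      (\<forall>a\<in>A. emeasure (frame_measure d b) a \<noteq> \<infinity>)" by blast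
qed

lemma nn_integral_frame_translate:
  assumes "orthonormal_seq (dot n) d b" "y \<in> span (b ` {..<d})" "f \<in> borel_measurable borel"
  shows "(\<integral>\<^sup>+x. f (x + y) \<partial>frame_measure d b) = (\<integral>\<^sup>+x. f x \<partial>frame_measure d b)"
  using nn_integral_frame_translate_comb[OF assms(3), where d = d and b = b and c = "\<lambda>i. dot n y (b i)"]
    inner_form.span_comb[OF inner_form_dot assms(1,2)] by simp

text \<open>
  Two measures \<open>\<mu>\<close> and \<open>\<lambda>\<close> that are invariant under the translations of one subspace are proportional,
  by the classical computation of \<open>\<integral>\<integral> 1\<^sub>S(y) 1\<^sub>A(x + y) d\<mu>(x) d\<lambda>(y)\<close> in two ways. For symmetric \<open>S\<close> it
  gives \<open>\<mu>(A) \<lambda>(S) = \<lambda>(A) \<mu>(S)\<close>. With the unit ball as \<open>S\<close>, which has the same measure in every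
  orthonormal system, the factor is 1.
\<close>

lemma frame_measure_unique:
  assumes b: "orthonormal_seq (dot n) d b" and b': "orthonormal_seq (dot n) d b'"
    and sp: "span (b ` {..<d}) = span (b' ` {..<d})"
  shows "frame_measure d b = frame_measure d b'"
proof (rule measure_eqI)
  let ?M = "frame_measure d b" and ?N = "frame_measure d b'"
  interpret M: sigma_finite_measure "?M" by (rule sigma_finite_frame[OF b])
  interpret L: sigma_finite_measure "?N" by (rule sigma_finite_frame[OF b'])
  interpret P: pair_sigma_finite "?M" "?N" by standard
  interpret I: inner_form n "dot n" by (rule inner_form_dot)
  show "sets ?M = sets ?N" by simp
  fix A assume "A \<in> sets ?M"
  then have [measurable]: "A \<in> sets borel" by simp
  define S :: "(nat \<Rightarrow> real) set" where "S = {x. dot n x x \<le> 1}"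
  have [measurable]: "S \<in> sets borel" unfolding S_def by measurable
  have Sm: "(- y :: nat \<Rightarrow> real) \<in> S \<longleftrightarrow> y \<in> S" for y by (simp add: S_def dot_def)
  let ?i = "\<lambda>X x. indicator X x :: ennreal"
  have "emeasure ?M A * emeasure ?N S = (\<integral>\<^sup>+y. ?i S y * (\<integral>\<^sup>+x. ?i A x \<partial>?M) \<partial>?N)"
    by (subst nn_integral_multc) (auto simp: mult.commute)
  also have "\<dots> = (\<integral>\<^sup>+y. ?i S y * (\<integral>\<^sup>+x. ?i A (x + y) \<partial>?M) \<partial>?N)"
  proof (rule nn_integral_frame_cong)
    fix y assume "y \<in> span (b' ` {..<d})"
    then have "y \<in> span (b ` {..<d})" using sp by simp
    note nn_integral_frame_translate[OF b this, of "?i A"]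
    then show "?i S y * (\<integral>\<^sup>+x. ?i A x \<partial>?M) = ?i S y * (\<integral>\<^sup>+x. ?i A (x + y) \<partial>?M)"
      by simp
  qed measurable
  also have "\<dots> = (\<integral>\<^sup>+y. (\<integral>\<^sup>+x. ?i S y * ?i A (x + y) \<partial>?M) \<partial>?N)"
    by (intro nn_integral_cong nn_integral_cmult[symmetric]) measurable
  also have "\<dots> = (\<integral>\<^sup>+x. (\<integral>\<^sup>+y. ?i S y * ?i A (x + y) \<partial>?N) \<partial>?M)"
    by (rule P.Fubini') measurable
  also have "\<dots> = (\<integral>\<^sup>+x. (\<integral>\<^sup>+y. ?i S (y - x) * ?i A y \<partial>?N) \<partial>?M)"
  proof (rule nn_integral_frame_cong)
    fix x assume x: "x \<in> span (b ` {..<d})"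
    then have "- x \<in> span (b' ` {..<d})" using sp span_neg by metis
    note nn_integral_frame_translate[OF b' this, of "\<lambda>y. ?i S y * ?i A (x + y)"]
    then show "(\<integral>\<^sup>+y. ?i S y * ?i A (x + y) \<partial>?N) = (\<integral>\<^sup>+y. ?i S (y - x) * ?i A y \<partial>?N)"
      by simp
  qed measurable
  also have "\<dots> = (\<integral>\<^sup>+x. (\<integral>\<^sup>+y. ?i S (y + (-1) *\<^sub>R x) * ?i A y \<partial>?N) \<partial>?M)"
    by simp
  also have "\<dots> = (\<integral>\<^sup>+y. (\<integral>\<^sup>+x. ?i S (y + (-1) *\<^sub>R x) * ?i A y \<partial>?M) \<partial>?N)"
    by (rule P.Fubini'[symmetric]) measurable
  also have "\<dots> = (\<integral>\<^sup>+y. (\<integral>\<^sup>+x. ?i S (x + (-1) *\<^sub>R y) \<partial>?M) * ?i A y \<partial>?N)"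
    using Sm[of "_ - _"]
    by (intro nn_integral_cong) (subst nn_integral_multc, measurable, auto simp: indicator_def)
  also have "\<dots> = (\<integral>\<^sup>+y. emeasure ?M S * ?i A y \<partial>?N)"
  proof (rule nn_integral_frame_cong)
    fix y assume "y \<in> span (b' ` {..<d})"
    then have "- y \<in> span (b ` {..<d})" using sp span_neg by metis
    note nn_integral_frame_translate[OF b this, of "?i S"]
    then show "(\<integral>\<^sup>+x. ?i S (x + (-1) *\<^sub>R y) \<partial>?M) * ?i A y = emeasure ?M S * ?i A y"
      by simp
  qed measurable
  also have "\<dots> = emeasure ?M S * emeasure ?N A"
    by (subst nn_integral_cmult) auto
  also have "emeasure ?M S = emeasure ?N S"
    unfolding S_def frame_ball[OF b] frame_ball[OF b'] ..
  finally have "emeasure ?N S * emeasure ?M A = emeasure ?N S * emeasure ?N A"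
    by (simp add: mult.commute)
  moreover have "emeasure ?N S \<noteq> 0" "emeasure ?N S \<noteq> \<infinity>"
    using frame_ball_positive[OF b', of 1] frame_ball_finite[OF b', of 1] by (auto simp: S_def)
  ultimately show "emeasure ?M A = emeasure ?N A"
    by (simp add: ennreal_mult_cancel_left)
qed

section \<open>The Prekopa-Leindler inequality\<close>

lemma emeasure_lborel_rescale:
  fixes r c :: real
  assumes "r > 0" and [measurable]: "X \<in> sets borel"
  shows "emeasure lborel {y. (y - c) / r \<in> X} = ennreal r * emeasure lborel X"
proof -
  have [measurable]: "{y. (y - c) / r \<in> X} \<in> sets borel" by measurable
  have "emeasure lborel {y. (y - c) / r \<in> X} = (\<integral>\<^sup>+y. indicator {y. (y - c) / r \<in> X} y \<partial>lborel)"
    by simp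
  also have "\<dots> = ennreal \<bar>r\<bar> * (\<integral>\<^sup>+x. indicator {y. (y - c) / r \<in> X} (c + r * x) \<partial>lborel)"
    using assms by (intro nn_integral_real_affine) auto
  also have "(\<integral>\<^sup>+x. indicator {y. (y - c) / r \<in> X} (c + r * x) \<partial>lborel) = (\<integral>\<^sup>+x. indicator X x \<partial>lborel)"
    using assms by (intro nn_integral_cong) (simp add: indicator_def)
  finally show ?thesis using assms by simp
qed

text \<open>
  Take a point \<open>a\<close> close to the top of \<open>A\<close> and a point \<open>b\<close> close to the bottom of \<open>B\<close>. The set
  \<open>(1 - \<theta>) A + \<theta> B\<close> contains a copy of \<open>(1 - \<theta>) A\<close> to the left of \<open>p = (1 - \<theta>) a + \<theta> b\<close> and a copy of
  \<open>\<theta> B\<close> to the right of \<open>p\<close>, up to pieces of measure at most \<open>e\<close>.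
\<close>

lemma brunn_minkowski_real:
  fixes A B C :: "real set"
  assumes [measurable]: "A \<in> sets borel" "B \<in> sets borel" "C \<in> sets borel"
    and ne: "A \<noteq> {}" "B \<noteq> {}" and bd: "bdd_above A" "bdd_below B"
    and t: "0 < \<theta>" "\<theta> < 1"
    and C: "\<And>a b. a \<in> A \<Longrightarrow> b \<in> B \<Longrightarrow> (1 - \<theta>) * a + \<theta> * b \<in> C"
  shows "ennreal (1 - \<theta>) * emeasure lborel A + ennreal \<theta> * emeasure lborel B \<le> emeasure lborel C"
proof (rule ennreal_le_epsilon)
  fix e :: real assume e: "e > 0"
  obtain a where a: "a \<in> A" "Sup A - e < a" using e ne bd less_cSup_iff[of A "Sup A - e"] by auto
  obtain b where b: "b \<in> B" "b < Inf B + e" using e ne bd cInf_less_iff[of B "Inf B + e"] by auto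
  define p where "p = (1 - \<theta>) * a + \<theta> * b"
  define P where "P = {y. (y - \<theta> * b) / (1 - \<theta>) \<in> A \<inter> {..a}}"
  define Q where "Q = {y. (y - (1 - \<theta>) * a) / \<theta> \<in> B \<inter> {b..}}"
  have [measurable]: "P \<in> sets borel" "Q \<in> sets borel" unfolding P_def Q_def by measurable
  have PC: "P \<subseteq> C \<inter> {..p}"
  proof
    fix y assume "y \<in> P"
    then have y: "(y - \<theta> * b) / (1 - \<theta>) \<in> A" "(y - \<theta> * b) / (1 - \<theta>) \<le> a" by (auto simp: P_def)
    have "(1 - \<theta>) * ((y - \<theta> * b) / (1 - \<theta>)) + \<theta> * b = y" using t by simp
    with C[OF y(1) b(1)] y(2) t show "y \<in> C \<inter> {..p}" by (simp add: p_def divide_simps mult.commute)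
  qed
  have QC: "Q \<subseteq> C \<inter> {p..}"
  proof
    fix y assume "y \<in> Q"
    then have y: "(y - (1 - \<theta>) * a) / \<theta> \<in> B" "b \<le> (y - (1 - \<theta>) * a) / \<theta>" by (auto simp: Q_def)
    have "(1 - \<theta>) * a + \<theta> * ((y - (1 - \<theta>) * a) / \<theta>) = y" using t by simp
    with C[OF a(1) y(1)] y(2) t show "y \<in> C \<inter> {p..}" by (simp add: p_def divide_simps mult.commute)
  qed
  have A': "emeasure lborel A \<le> emeasure lborel (A \<inter> {..a}) + ennreal e"
  proof -
    have "A \<subseteq> (A \<inter> {..a}) \<union> {a..a+e}"
      using a cSup_upper[OF _ bd(1)] by (force simp: not_le)
    then have "emeasure lborel A \<le> emeasure lborel ((A \<inter> {..a}) \<union> {a..a+e})" by (intro emeasure_mono) auto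
    also have "\<dots> \<le> emeasure lborel (A \<inter> {..a}) + emeasure lborel {a..a+e}" by (intro emeasure_subadditive) auto
    finally show ?thesis using e by simp
  qed
  have B': "emeasure lborel B \<le> emeasure lborel (B \<inter> {b..}) + ennreal e"
  proof -
    have "B \<subseteq> (B \<inter> {b..}) \<union> {b-e..b}"
      using b cInf_lower[OF _ bd(2)] by (force simp: not_le)
    then have "emeasure lborel B \<le> emeasure lborel ((B \<inter> {b..}) \<union> {b-e..b})" by (intro emeasure_mono) auto
    also have "\<dots> \<le> emeasure lborel (B \<inter> {b..}) + emeasure lborel {b-e..b}" by (intro emeasure_subadditive) auto
    finally show ?thesis using e by simp
  qed
  have eP: "emeasure lborel P = ennreal (1 - \<theta>) * emeasure lborel (A \<inter> {..a})"
    unfolding P_def using t by (intro emeasure_lborel_rescale) auto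
  have eQ: "emeasure lborel Q = ennreal \<theta> * emeasure lborel (B \<inter> {b..})"
    unfolding Q_def using t by (intro emeasure_lborel_rescale) auto
  have "ennreal (1 - \<theta>) * emeasure lborel A + ennreal \<theta> * emeasure lborel B
     \<le> ennreal (1 - \<theta>) * (emeasure lborel (A \<inter> {..a}) + ennreal e) + ennreal \<theta> * (emeasure lborel (B \<inter> {b..}) + ennreal e)"
    by (intro add_mono mult_left_mono A' B') auto
  also have "\<dots> = emeasure lborel P + emeasure lborel Q + (ennreal (1 - \<theta>) * ennreal e + ennreal \<theta> * ennreal e)"
    unfolding eP eQ by (simp add: distrib_left ac_simps)
  also have "ennreal (1 - \<theta>) * ennreal e + ennreal \<theta> * ennreal e = ennreal e"
    using t e by (simp add: distrib_right[symmetric] ennreal_plus[symmetric] del: ennreal_plus)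
  also have "emeasure lborel P = emeasure lborel (P - {p})"
    by (intro emeasure_Diff_null_set[symmetric]) auto
  also have "emeasure lborel (P - {p}) + emeasure lborel Q = emeasure lborel ((P - {p}) \<union> Q)"
    using PC QC by (intro plus_emeasure) force+
  also have "\<dots> \<le> emeasure lborel C"
    using PC QC by (intro emeasure_mono) auto
  finally show "ennreal (1 - \<theta>) * emeasure lborel A + ennreal \<theta> * emeasure lborel B \<le> emeasure lborel C + ennreal e"
    by (simp add: add_right_mono)
qed

lemma nn_integral_layer_cake:
  fixes f :: "real \<Rightarrow> real"
  assumes [measurable]: "f \<in> borel_measurable borel"
  shows "(\<integral>\<^sup>+x. ennreal (f x) \<partial>lborel) = (\<integral>\<^sup>+s. indicator {0<..} s * emeasure lborel {x. s < f x} \<partial>lborel)"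
proof -
  have "(\<integral>\<^sup>+x. ennreal (f x) \<partial>lborel) = (\<integral>\<^sup>+x. (\<integral>\<^sup>+s. indicator {0<..} s * indicator {x. s < f x} x \<partial>lborel) \<partial>lborel)"
  proof (rule nn_integral_cong)
    fix x
    have "(\<integral>\<^sup>+s. indicator {0<..} s * indicator {x. s < f x} x \<partial>lborel) = (\<integral>\<^sup>+s. indicator {0<..<f x} s \<partial>lborel)"
      by (intro nn_integral_cong) (auto simp: indicator_def)
    also have "\<dots> = ennreal (f x)" by (cases "0 \<le> f x") (auto simp: ennreal_neg)
    finally show "ennreal (f x) = (\<integral>\<^sup>+s. indicator {0<..} s * indicator {x. s < f x} x \<partial>lborel)" ..
  qed
  also have "\<dots> = (\<integral>\<^sup>+s. (\<integral>\<^sup>+x. indicator {0<..} s * indicator {x. s < f x} x \<partial>lborel) \<partial>lborel)"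
    by (rule lborel_pair.Fubini'[symmetric]) measurable
  also have "\<dots> = (\<integral>\<^sup>+s. indicator {0<..} s * emeasure lborel {x. s < f x} \<partial>lborel)"
    by (intro nn_integral_cong) (subst nn_integral_cmult, auto)
  finally show ?thesis .
qed

text \<open>
  The class of functions for which the Prekopa-Leindler inequality is proved, here on the line and
  below in several coordinates. All integrals are finite, and the class is stable under integration
  over some of the coordinates.
\<close>

definition bounded_supp1 :: "(real \<Rightarrow> real) \<Rightarrow> bool"
  where "bounded_supp1 f \<longleftrightarrow> f \<in> borel_measurable borel \<and>
    (\<exists>C R. \<forall>x. 0 \<le> f x \<and> f x \<le> C \<and> (f x \<noteq> 0 \<longrightarrow> \<bar>x\<bar> \<le> R))"

lemma bounded_supp1E:
  assumes "bounded_supp1 f"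
  obtains C R where "f \<in> borel_measurable borel" "\<And>x. 0 \<le> f x" "\<And>x. f x \<le> C" "\<And>x. f x \<noteq> 0 \<Longrightarrow> \<bar>x\<bar> \<le> R"
  using assms unfolding bounded_supp1_def by blast

lemma bounded_supp1_integrable:
  assumes "bounded_supp1 f"
  shows "integrable lborel f"
proof -
  obtain C R where *: "f \<in> borel_measurable borel" "\<And>x. 0 \<le> f x" "\<And>x. f x \<le> C" "\<And>x. f x \<noteq> 0 \<Longrightarrow> \<bar>x\<bar> \<le> R"
    using bounded_supp1E[OF assms] by metis
  show ?thesis
    by (rule integrableI_bounded_set[of "{-R..R}" _ _ C]) (use * in \<open>force intro: AE_I2 simp: less_top[symmetric] emeasure_lborel_Icc_eq\<close>)+
qed

text \<open>
  When the suprema of \<open>F\<close> and \<open>G\<close> are 1, the levels \<open>0 < s < 1\<close> are those for which both superlevel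
  sets are nonempty, so the one-dimensional Brunn-Minkowski inequality applies to each of them and
  can be integrated over \<open>s\<close>.
\<close>

lemma prekopa_leindler_normalized:
  fixes F G H :: "real \<Rightarrow> real"
  assumes t: "0 < \<theta>" "\<theta> < 1"
    and F: "bounded_supp1 F" and G: "bounded_supp1 G" and H: "bounded_supp1 H"
    and F1: "\<And>x. F x \<le> 1" "\<And>s. s < 1 \<Longrightarrow> \<exists>x. s < F x"
    and G1: "\<And>x. G x \<le> 1" "\<And>s. s < 1 \<Longrightarrow> \<exists>x. s < G x"
    and FGH: "\<And>x y. F x powr (1 - \<theta>) * G y powr \<theta> \<le> H ((1 - \<theta>) * x + \<theta> * y)"
  shows "(1 - \<theta>) * (\<integral>x. F x \<partial>lborel) + \<theta> * (\<integral>x. G x \<partial>lborel) \<le> (\<integral>x. H x \<partial>lborel)"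
proof -
  have [measurable]: "F \<in> borel_measurable borel" "G \<in> borel_measurable borel" "H \<in> borel_measurable borel"
    using F G H by (auto simp: bounded_supp1_def)
  have nn: "\<And>x. 0 \<le> F x" "\<And>x. 0 \<le> G x" "\<And>x. 0 \<le> H x" using F G H by (auto simp: bounded_supp1_def)
  obtain RF where RF: "\<And>x. F x \<noteq> 0 \<Longrightarrow> \<bar>x\<bar> \<le> RF" using bounded_supp1E[OF F] by metis
  obtain RG where RG: "\<And>x. G x \<noteq> 0 \<Longrightarrow> \<bar>x\<bar> \<le> RG" using bounded_supp1E[OF G] by metis
  have I: "integrable lborel F" "integrable lborel G" "integrable lborel H"
    using F G H bounded_supp1_integrable by auto
  have "ennreal (1 - \<theta>) * (\<integral>\<^sup>+x. ennreal (F x) \<partial>lborel) + ennreal \<theta> * (\<integral>\<^sup>+x. ennreal (G x) \<partial>lborel)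
    = (\<integral>\<^sup>+s. ennreal (1 - \<theta>) * (indicator {0<..} s * emeasure lborel {x. s < F x})
         + ennreal \<theta> * (indicator {0<..} s * emeasure lborel {x. s < G x}) \<partial>lborel)"
    by (subst nn_integral_add, measurable) (simp add: nn_integral_layer_cake nn_integral_cmult)
  also have "\<dots> \<le> (\<integral>\<^sup>+s. indicator {0<..} s * emeasure lborel {x. s < H x} \<partial>lborel)"
  proof (rule nn_integral_mono)
    fix s :: real
    consider "s \<le> 0" | "0 < s" "s < 1" | "s \<ge> 1" by linarith
    then show "ennreal (1 - \<theta>) * (indicator {0<..} s * emeasure lborel {x. s < F x})
         + ennreal \<theta> * (indicator {0<..} s * emeasure lborel {x. s < G x})
         \<le> indicator {0<..} s * emeasure lborel {x. s < H x}"
    proof cases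
      case 2
      have "ennreal (1 - \<theta>) * emeasure lborel {x. s < F x} + ennreal \<theta> * emeasure lborel {x. s < G x}
        \<le> emeasure lborel {x. s < H x}"
      proof (rule brunn_minkowski_real[OF _ _ _ _ _ _ _ t])
        show "{x. s < F x} \<noteq> {}" "{x. s < G x} \<noteq> {}" using F1(2) G1(2) 2 by auto
        show "bdd_above {x. s < F x}" 
        proof (rule bdd_aboveI[of _ RF])
          fix x assume "x \<in> {x. s < F x}"
          then show "x \<le> RF" using RF[of x] 2 by auto
        qed
        show "bdd_below {x. s < G x}" 
        proof (rule bdd_belowI[of _ "-RG"])
          fix x assume "x \<in> {x. s < G x}"
          then show "-RG \<le> x" using RG[of x] 2 by auto
        qed
        fix a b assume ab: "a \<in> {x. s < F x}" "b \<in> {x. s < G x}"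
        have "s = s powr (1 - \<theta>) * s powr \<theta>" using 2 by (simp add: powr_add[symmetric])
        also have "\<dots> < F a powr (1 - \<theta>) * G b powr \<theta>"
          using ab 2 t by (intro mult_strict_mono powr_less_mono2) auto
        also note FGH[of a b]
        finally show "(1 - \<theta>) * a + \<theta> * b \<in> {x. s < H x}" by simp
      qed measurable
      then show ?thesis using 2 by simp
    next
      case 3
      then have e: "{x. s < F x} = {}" "{x. s < G x} = {}" using F1(1) G1(1) by (auto simp: not_less intro: order_trans)
      show ?thesis unfolding e by simp
    qed simp
  qed
  also have "\<dots> = (\<integral>\<^sup>+x. ennreal (H x) \<partial>lborel)" by (simp add: nn_integral_layer_cake)
  finally have "ennreal (1 - \<theta>) * ennreal (\<integral>x. F x \<partial>lborel) + ennreal \<theta> * ennreal (\<integral>x. G x \<partial>lborel) \<le> ennreal (\<integral>x. H x \<partial>lborel)"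
    using I nn by (simp add: nn_integral_eq_integral)
  then show ?thesis using t nn
    by (simp add: ennreal_mult[symmetric] ennreal_plus[symmetric] Bochner_Integration.integral_nonneg del: ennreal_plus)
qed

text \<open>
  The arithmetic mean in the normalized inequality dominates the geometric mean, and the geometric
  form is homogeneous in \<open>f\<close>, \<open>g\<close> and \<open>h\<close>, so the normalization can be undone.
\<close>

lemma prekopa_leindler_real:
  fixes f g h :: "real \<Rightarrow> real"
  assumes t: "0 < \<theta>" "\<theta> < 1"
    and f: "bounded_supp1 f" and g: "bounded_supp1 g" and h: "bounded_supp1 h"
    and fgh: "\<And>x y. f x powr (1 - \<theta>) * g y powr \<theta> \<le> h ((1 - \<theta>) * x + \<theta> * y)"
  shows "(\<integral>x. f x \<partial>lborel) powr (1 - \<theta>) * (\<integral>x. g x \<partial>lborel) powr \<theta> \<le> (\<integral>x. h x \<partial>lborel)"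
proof -
  have nn: "\<And>x. 0 \<le> f x" "\<And>x. 0 \<le> g x" "\<And>x. 0 \<le> h x" using f g h by (auto simp: bounded_supp1_def)
  have hi: "0 \<le> (\<integral>x. h x \<partial>lborel)" using nn by simp
  show ?thesis
  proof (cases "(\<forall>x. f x = 0) \<or> (\<forall>x. g x = 0)")
    case True
    then show ?thesis using hi by auto
  next
    case False
    then obtain x0 y0 where xy: "f x0 > 0" "g y0 > 0" using nn by (metis less_eq_real_def)
    have bd: "bdd_above (range f)" "bdd_above (range g)"
      using f g by (auto simp: bounded_supp1_def bdd_above_def)
    define a b where "a = Sup (range f)" and "b = Sup (range g)"
    have a: "a > 0" "\<And>x. f x \<le> a" unfolding a_def
      using xy(1) cSup_upper[OF _ bd(1)] by (auto intro: less_le_trans)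
    have b: "b > 0" "\<And>x. g x \<le> b" unfolding b_def
      using xy(2) cSup_upper[OF _ bd(2)] by (auto intro: less_le_trans)
    define c where "c = a powr (1 - \<theta>) * b powr \<theta>"
    have c: "c > 0" using a b by (simp add: c_def)
    have scale: "bounded_supp1 (\<lambda>x. u x / r)" if u: "bounded_supp1 u" and r: "r > 0" for u r
    proof -
      obtain C R where *: "u \<in> borel_measurable borel" "\<And>x. 0 \<le> u x" "\<And>x. u x \<le> C" "\<And>x. u x \<noteq> 0 \<Longrightarrow> \<bar>x\<bar> \<le> R"
        using bounded_supp1E[OF u] by metis
      note [measurable] = *(1)
      show ?thesis unfolding bounded_supp1_def
        using * r by (intro conjI exI[of _ "C / r"] exI[of _ R]) (auto intro: divide_right_mono)
    qed
    let ?If = "\<integral>x. f x \<partial>lborel" and ?Ig = "\<integral>x. g x \<partial>lborel" and ?Ih = "\<integral>x. h x \<partial>lborel"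
    have "(1 - \<theta>) * (\<integral>x. f x / a \<partial>lborel) + \<theta> * (\<integral>x. g x / b \<partial>lborel) \<le> (\<integral>x. h x / c \<partial>lborel)"
    proof (rule prekopa_leindler_normalized[OF t])
      show "bounded_supp1 (\<lambda>x. f x / a)" "bounded_supp1 (\<lambda>x. g x / b)" "bounded_supp1 (\<lambda>x. h x / c)"
        using scale f g h a b c by auto
      show "f x / a \<le> 1" "g x / b \<le> 1" for x using a b by auto
      show "\<exists>x. s < f x / a" if "s < 1" for s
      proof -
        have "s * a < Sup (range f)" using that a by (simp add: a_def[symmetric])
        then obtain x where "s * a < f x" using less_cSup_iff[OF _ bd(1)] by auto
        then show ?thesis using a by (auto simp: field_simps)
      qed
      show "\<exists>x. s < g x / b" if "s < 1" for s
      proof -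
        have "s * b < Sup (range g)" using that b by (simp add: b_def[symmetric])
        then obtain x where "s * b < g x" using less_cSup_iff[OF _ bd(2)] by auto
        then show ?thesis using b by (auto simp: field_simps)
      qed
      fix x y
      have "(f x / a) powr (1 - \<theta>) * (g y / b) powr \<theta> = (f x powr (1 - \<theta>) * g y powr \<theta>) / c"
        using a b nn by (simp add: c_def powr_divide)
      also have "\<dots> \<le> h ((1 - \<theta>) * x + \<theta> * y) / c" using fgh c by (intro divide_right_mono) auto
      finally show "(f x / a) powr (1 - \<theta>) * (g y / b) powr \<theta> \<le> h ((1 - \<theta>) * x + \<theta> * y) / c" .
    qed
    then have i: "(1 - \<theta>) * (?If / a) + \<theta> * (?Ig / b) \<le> ?Ih / c" by simp
    show ?thesis
    proof (cases "?If > 0 \<and> ?Ig > 0")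
      case True
      have "?If powr (1 - \<theta>) * ?Ig powr \<theta> / c = (?If / a) powr (1 - \<theta>) * (?Ig / b) powr \<theta>"
        using a b True by (simp add: c_def powr_divide)
      also have "\<dots> \<le> (1 - \<theta>) * (?If / a) + \<theta> * (?Ig / b)"
        using True a b t by (intro Youngs_inequality_0) auto
      also note i
      finally show ?thesis using c by (simp add: field_simps)
    next
      case False
      moreover have "?If \<ge> 0" "?Ig \<ge> 0" using nn by auto
      ultimately have "?If = 0 \<or> ?Ig = 0" by linarith
      then show ?thesis using hi by auto
    qed
  qed
qed

definition bounded_supp :: "nat \<Rightarrow> ((nat \<Rightarrow> real) \<Rightarrow> real) \<Rightarrow> bool"
  where "bounded_supp d f \<longleftrightarrow> f \<in> borel_measurable (coord_measure d) \<and>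
    (\<exists>C R. \<forall>c. 0 \<le> f c \<and> f c \<le> C \<and> (f c \<noteq> 0 \<longrightarrow> (\<forall>i<d. \<bar>c i\<bar> \<le> R)))"

lemma bounded_suppE:
  assumes "bounded_supp d f"
  obtains C R where "f \<in> borel_measurable (coord_measure d)" "\<And>c. 0 \<le> f c" "\<And>c. f c \<le> C"
    "\<And>c i. f c \<noteq> 0 \<Longrightarrow> i < d \<Longrightarrow> \<bar>c i\<bar> \<le> R" "R \<ge> 0" "C \<ge> 0"
proof -
  obtain C R where *: "f \<in> borel_measurable (coord_measure d)" "\<And>c. 0 \<le> f c" "\<And>c. f c \<le> C"
    "\<And>c i. f c \<noteq> 0 \<Longrightarrow> i < d \<Longrightarrow> \<bar>c i\<bar> \<le> R"
    using assms unfolding bounded_supp_def by blast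
  show ?thesis
    by (rule that[of C "max 0 R"]) (use * in \<open>auto intro: order_trans le_max_iff_disj[THEN iffD2]\<close>)
qed

lemma box_coord: "({..<d} \<rightarrow>\<^sub>E {-R..R::real}) \<in> sets (coord_measure d)"
  "emeasure (coord_measure d) ({..<d} \<rightarrow>\<^sub>E {-R..R}) < \<infinity>"
proof -
  have "emeasure lborel {-R..R} = ennreal (max 0 (2 * R))"
    by (cases "R \<ge> 0") (auto simp: max_def)
  then show "emeasure (coord_measure d) ({..<d} \<rightarrow>\<^sub>E {-R..R}) < \<infinity>"
    by (simp add: lborel_product.emeasure_PiM ennreal_power less_top[symmetric])
qed (auto intro!: sets_PiM_I_finite)

lemma bounded_supp_integrable:
  assumes "bounded_supp d f"
  shows "integrable (coord_measure d) f"
proof -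
  obtain C R where *: "f \<in> borel_measurable (coord_measure d)" "\<And>c. 0 \<le> f c" "\<And>c. f c \<le> C"
    "\<And>c i. f c \<noteq> 0 \<Longrightarrow> i < d \<Longrightarrow> \<bar>c i\<bar> \<le> R" using bounded_suppE[OF assms] by metis
  show ?thesis
  proof (rule integrableI_bounded_set[OF box_coord(1)[of d R] *(1) box_coord(2)])
    show "AE x in coord_measure d. x \<in> {..<d} \<rightarrow>\<^sub>E {-R..R} \<longrightarrow> norm (f x) \<le> C" using * by auto
    show "AE x in coord_measure d. x \<notin> {..<d} \<rightarrow>\<^sub>E {-R..R} \<longrightarrow> f x = 0"
    proof (rule AE_I2, rule impI, rule ccontr)
      fix x assume x: "x \<in> space (coord_measure d)" "x \<notin> {..<d} \<rightarrow>\<^sub>E {-R..R}" "f x \<noteq> 0"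
      have "x i \<in> {-R..R}" if "i < d" for i using *(4)[OF x(3) that] by auto
      with x show False by (auto simp: space_PiM PiE_def)
    qed
  qed
qed

lemma integral_coord_Suc:
  assumes "bounded_supp (Suc d) f"
  defines "F \<equiv> \<lambda>t. \<integral>c. f (c(d := t)) \<partial>coord_measure d"
  shows "\<And>t. bounded_supp d (\<lambda>c. f (c(d := t)))" "bounded_supp1 F"
    "(\<integral>c. f c \<partial>coord_measure (Suc d)) = (\<integral>t. F t \<partial>lborel)"
proof -
  obtain C R where *: "f \<in> borel_measurable (coord_measure (Suc d))" "\<And>c. 0 \<le> f c" "\<And>c. f c \<le> C"
    "\<And>c i. f c \<noteq> 0 \<Longrightarrow> i < Suc d \<Longrightarrow> \<bar>c i\<bar> \<le> R" "R \<ge> 0" "C \<ge> 0" using bounded_suppE[OF assms(1)] by metis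
  have [measurable]: "f \<in> borel_measurable (Pi\<^sub>M (insert d {..<d}) (\<lambda>_. lborel))"
    using *(1) by (simp add: lessThan_Suc)
  interpret sigma_finite_measure "coord_measure d" by (rule sigma_finite_coord)
  have m: "(\<lambda>c. f (c(d := t))) \<in> borel_measurable (coord_measure d)" for t by measurable
  show bs: "bounded_supp d (\<lambda>c. f (c(d := t)))" for t
  proof -
    have "\<forall>c. 0 \<le> f (c(d := t)) \<and> f (c(d := t)) \<le> C \<and> (f (c(d := t)) \<noteq> 0 \<longrightarrow> (\<forall>i<d. \<bar>c i\<bar> \<le> R))"
    proof (intro allI conjI impI)
      fix c i assume "f (c(d := t)) \<noteq> 0" "i < d"
      with *(4)[of "c(d := t)" i] show "\<bar>c i\<bar> \<le> R" by simp
    qed (use * in auto)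
    then show ?thesis using m[of t] unfolding bounded_supp_def by blast
  qed
  have Fm [measurable]: "F \<in> borel_measurable borel" unfolding F_def by measurable
  have F0: "0 \<le> F t" for t unfolding F_def using * by simp
  have Fsupp: "F t = 0" if "\<bar>t\<bar> > R" for t
  proof -
    have "f (c(d := t)) = 0" for c using *(4)[of "c(d := t)" d] that by force
    then show ?thesis by (simp add: F_def)
  qed
  have FC: "F t \<le> C * measure (coord_measure d) ({..<d} \<rightarrow>\<^sub>E {-R..R})" for t
  proof -
    have "F t \<le> (\<integral>c. C * indicator ({..<d} \<rightarrow>\<^sub>E {-R..R}) c \<partial>coord_measure d)"
      unfolding F_def
    proof (rule integral_mono)
      show "integrable (coord_measure d) (\<lambda>c. f (c(d := t)))" by (rule bounded_supp_integrable[OF bs])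
      show "integrable (coord_measure d) (\<lambda>c. C * indicator ({..<d} \<rightarrow>\<^sub>E {-R..R}) c :: real)"
        using box_coord[of d R] by (intro integrable_mult_right integrable_real_indicator) auto
      fix c assume c: "c \<in> space (coord_measure d)"
      show "f (c(d := t)) \<le> C * indicator ({..<d} \<rightarrow>\<^sub>E {-R..R}) c"
      proof (cases "f (c(d := t)) = 0")
        case False
        have "c i \<in> {-R..R}" if "i < d" for i using *(4)[OF False, of i] that by auto
        then have "c \<in> {..<d} \<rightarrow>\<^sub>E {-R..R}" using c by (auto simp: space_PiM PiE_def)
        then show ?thesis using * by simp
      qed (use * in simp)
    qed
    then show ?thesis using box_coord(1)[of d R] by simp
  qed
  show F: "bounded_supp1 F"
    unfolding bounded_supp1_def using Fm F0 FC Fsupp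
    by (intro conjI exI[of _ "C * measure (coord_measure d) ({..<d} \<rightarrow>\<^sub>E {-R..R})"] exI[of _ R]) (auto simp: not_less[symmetric])
  have "ennreal (\<integral>c. f c \<partial>coord_measure (Suc d)) = (\<integral>\<^sup>+c. ennreal (f c) \<partial>coord_measure (Suc d))"
    using * bounded_supp_integrable[OF assms(1)] by (simp add: nn_integral_eq_integral)
  also have "\<dots> = (\<integral>\<^sup>+c. ennreal (f c) \<partial>Pi\<^sub>M (insert d {..<d}) (\<lambda>_. lborel))" by (simp add: lessThan_Suc)
  also have "\<dots> = (\<integral>\<^sup>+t. (\<integral>\<^sup>+c. ennreal (f (c(d := t))) \<partial>coord_measure d) \<partial>lborel)"
    by (rule lborel_product.product_nn_integral_insert_rev) auto
  also have "\<dots> = (\<integral>\<^sup>+t. ennreal (F t) \<partial>lborel)"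
    unfolding F_def using * bounded_supp_integrable[OF bs] by (simp add: nn_integral_eq_integral)
  also have "\<dots> = ennreal (\<integral>t. F t \<partial>lborel)"
    using F0 bounded_supp1_integrable[OF F] by (simp add: nn_integral_eq_integral)
  finally show "(\<integral>c. f c \<partial>coord_measure (Suc d)) = (\<integral>t. F t \<partial>lborel)"
    using * F0 by simp
qed

text \<open>
  The inequality tensorizes: integrating out the first \<open>d\<close> coordinates turns the hypothesis for
  \<open>f, g, h\<close> into the hypothesis on the line for the marginals.
\<close>

lemma prekopa_leindler:
  assumes t: "0 < \<theta>" "\<theta> < 1"
    and "bounded_supp d f" "bounded_supp d g" "bounded_supp d h"
    and "\<And>x y. f x powr (1 - \<theta>) * g y powr \<theta> \<le> h ((1 - \<theta>) *\<^sub>R x + \<theta> *\<^sub>R y)"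
  shows "(\<integral>x. f x \<partial>coord_measure d) powr (1 - \<theta>) * (\<integral>x. g x \<partial>coord_measure d) powr \<theta>
    \<le> (\<integral>x. h x \<partial>coord_measure d)"
  using assms(3-)
proof (induction d arbitrary: f g h)
  case 0
  have i: "(\<integral>x. f x \<partial>coord_measure 0) = f (\<lambda>_. undefined)" for f :: "(nat \<Rightarrow> real) \<Rightarrow> real"
    by (simp add: PiM_empty lebesgue_integral_count_space_finite)
  show ?case unfolding i using "0.prems"(4)[of "\<lambda>_. undefined" "\<lambda>_. undefined"]
    by (simp add: scaleR_left.add[symmetric] scaleR_add_left[symmetric])
next
  case (Suc d)
  note F = integral_coord_Suc[OF Suc.prems(1)] and G = integral_coord_Suc[OF Suc.prems(2)]
    and H = integral_coord_Suc[OF Suc.prems(3)]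
  show ?case unfolding F(3) G(3) H(3)
  proof (rule prekopa_leindler_real[OF t F(2) G(2) H(2)])
    fix s t
    show "(\<integral>c. f (c(d := s)) \<partial>coord_measure d) powr (1 - \<theta>) * (\<integral>c. g (c(d := t)) \<partial>coord_measure d) powr \<theta>
      \<le> (\<integral>c. h (c(d := (1 - \<theta>) * s + \<theta> * t)) \<partial>coord_measure d)"
    proof (rule Suc.IH[OF F(1) G(1) H(1)])
      fix x y :: "nat \<Rightarrow> real"
      have "(1 - \<theta>) *\<^sub>R x(d := s) + \<theta> *\<^sub>R y(d := t) = ((1 - \<theta>) *\<^sub>R x + \<theta> *\<^sub>R y)(d := (1 - \<theta>) * s + \<theta> * t)"
        by (auto simp: fun_vec_simps)
      with Suc.prems(4)[of "x(d := s)" "y(d := t)"]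
      show "f (x(d := s)) powr (1 - \<theta>) * g (y(d := t)) powr \<theta>
        \<le> h (((1 - \<theta>) *\<^sub>R x + \<theta> *\<^sub>R y)(d := (1 - \<theta>) * s + \<theta> * t))" by (simp only:)
    qed
  qed
qed

section \<open>Second moments of even log-concave functions\<close>

lemma bounded_supp1_mult:
  assumes "bounded_supp1 f" and [measurable]: "g \<in> borel_measurable borel"
    and "\<And>x. 0 \<le> g x" "\<And>R. \<exists>C. \<forall>x. \<bar>x\<bar> \<le> R \<longrightarrow> g x \<le> C"
  shows "bounded_supp1 (\<lambda>x. g x * f x)"
proof -
  obtain C R where *: "f \<in> borel_measurable borel" "\<And>x. 0 \<le> f x" "\<And>x. f x \<le> C" "\<And>x. f x \<noteq> 0 \<Longrightarrow> \<bar>x\<bar> \<le> R"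
    using bounded_supp1E[OF assms(1)] by metis
  note [measurable] = *(1)
  obtain E where E: "\<And>x. \<bar>x\<bar> \<le> R \<Longrightarrow> g x \<le> E" using assms(4) by blast
  have "C \<ge> 0" using *(2,3) order_trans by blast
  have "g x * f x \<le> max 0 E * C" for x
  proof (cases "f x = 0")
    case False
    then have "g x \<le> max 0 E" using E[OF *(4)[OF False]] by simp
    then show ?thesis using * \<open>C \<ge> 0\<close> assms(3) by (intro mult_mono) auto
  qed (use \<open>C \<ge> 0\<close> in simp)
  then show ?thesis unfolding bounded_supp1_def
    using * assms(3) by (intro conjI exI[of _ "max 0 E * C"] exI[of _ R]) auto
qed

lemma bounded_supp1_sq:
  assumes "bounded_supp1 f"
  shows "bounded_supp1 (\<lambda>x. x\<^sup>2 * f x)"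
proof (rule bounded_supp1_mult[OF assms])
  fix R :: real
  show "\<exists>C. \<forall>x. \<bar>x\<bar> \<le> R \<longrightarrow> x\<^sup>2 \<le> C"
    by (rule exI[of _ "R\<^sup>2"]) (auto simp: abs_le_square_iff[symmetric])
qed auto

text \<open>
  The functions \<open>t \<mapsto> |K \<inter> (H + t v)|\<close> for a symmetric convex body \<open>K\<close> and a hyperplane \<open>H\<close>.
\<close>

locale even_log_concave =
  fixes f :: "real \<Rightarrow> real"
  assumes supp: "bounded_supp1 f"
    and even: "f (- t) = f t"
    and log_concave: "0 < \<theta> \<Longrightarrow> \<theta> < 1 \<Longrightarrow> f s powr (1 - \<theta>) * f t powr \<theta> \<le> f ((1 - \<theta>) * s + \<theta> * t)"
begin

lemma nonneg: "0 \<le> f t" using supp by (auto simp: bounded_supp1_def)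

lemma midpoint: "f s * f t \<le> (f ((s + t) / 2))\<^sup>2"
proof -
  have "sqrt (f s) * sqrt (f t) \<le> f ((s + t) / 2)"
    using log_concave[of "1/2" s t] nonneg by (simp add: powr_half_sqrt field_simps)
  then have "(sqrt (f s) * sqrt (f t))\<^sup>2 \<le> (f ((s + t) / 2))\<^sup>2"
    using nonneg by (intro power_mono) auto
  then show ?thesis using nonneg by (simp add: power_mult_distrib)
qed

lemma max_at_0: "f t \<le> f 0"
  using midpoint[of t "-t"] nonneg even[of t] by (simp add: power2_eq_square[symmetric])

lemma decreasing:
  assumes "0 \<le> s" "s \<le> t"
  shows "f t \<le> f s"
proof -
  consider "s = 0" | "s = t" | "0 < s" "s < t" using assms by linarith
  then show ?thesis
  proof cases
    case 3
    then have th: "0 < s / t" "s / t < 1" by auto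
    have "f t = f t powr (1 - s / t) * f t powr (s / t)" using nonneg[of t] by (simp add: powr_add[symmetric])
    also have "\<dots> \<le> f 0 powr (1 - s / t) * f t powr (s / t)"
      using th max_at_0 nonneg by (intro mult_right_mono powr_mono2) auto
    also have "\<dots> \<le> f ((1 - s / t) * 0 + s / t * t)" by (rule log_concave[OF th])
    finally show ?thesis using 3 by simp
  qed (use max_at_0 in auto)
qed

text \<open>
  A function that is bounded by \<open>f(0)\<close> has the least second moment if its mass sits near 0. Cutting
  at \<open>a = S / (4 f(0))\<close>, where \<open>S\<close> is the total mass, leaves at least half of the mass outside
  \<open>[-a, a]\<close>.
\<close>

lemma second_moment_lower:
  "(\<integral>t. f t \<partial>lborel) ^ 3 \<le> 32 * (f 0)\<^sup>2 * (\<integral>t. t\<^sup>2 * f t \<partial>lborel)"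
proof (cases "f 0 = 0")
  case True
  then have "f t = 0" for t using max_at_0[of t] nonneg[of t] by simp
  then show ?thesis by simp
next
  case False
  let ?S = "\<integral>t. f t \<partial>lborel" and ?J = "\<integral>t. t\<^sup>2 * f t \<partial>lborel" and ?M = "f 0"
  have M: "?M > 0" using False nonneg[of 0] by simp
  have S: "?S \<ge> 0" using nonneg by simp
  define a where "a = ?S / (4 * ?M)"
  have a: "a \<ge> 0" using S M by (simp add: a_def)
  have "(\<integral>t. a\<^sup>2 * f t - (a\<^sup>2 * ?M) * indicator {-a..a} t \<partial>lborel) \<le> ?J"
  proof (rule integral_mono)
    show "integrable lborel (\<lambda>t. a\<^sup>2 * f t - (a\<^sup>2 * ?M) * indicator {-a..a} t)"
      using bounded_supp1_integrable[OF supp] by (auto intro!: integrable_real_indicator simp: emeasure_lborel_Icc_eq)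
    show "integrable lborel (\<lambda>t. t\<^sup>2 * f t)" by (rule bounded_supp1_integrable[OF bounded_supp1_sq[OF supp]])
    fix t
    show "a\<^sup>2 * f t - (a\<^sup>2 * ?M) * indicator {-a..a} t \<le> t\<^sup>2 * f t"
    proof (cases "t \<in> {-a..a}")
      case True
      have "a\<^sup>2 * f t \<le> a\<^sup>2 * ?M" using max_at_0 by (intro mult_left_mono) auto
      moreover have "0 \<le> t\<^sup>2 * f t" using nonneg by simp
      ultimately show ?thesis using True by simp
    next
      case False
      then have "a\<^sup>2 \<le> t\<^sup>2" using a by (intro abs_le_square_iff[THEN iffD1]) auto
      then show ?thesis using False nonneg by (simp add: mult_right_mono)
    qed
  qed
  also have "(\<integral>t. a\<^sup>2 * f t - (a\<^sup>2 * ?M) * indicator {-a..a} t \<partial>lborel) = a\<^sup>2 * ?S - a\<^sup>2 * ?M * (2 * a)"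
    using bounded_supp1_integrable[OF supp] a
    by (subst Bochner_Integration.integral_diff) (auto intro!: integrable_real_indicator simp: emeasure_lborel_Icc_eq)
  also have "\<dots> = ?S ^ 3 / (32 * ?M\<^sup>2)"
    using M by (simp add: a_def field_simps power2_eq_square power3_eq_cube)
  finally show ?thesis using M by (simp add: field_simps)
qed

text \<open>
  The second moment \<open>J\<close> is estimated by itself. Doubling the variable gives
  \<open>J = 8 \<integral> s\<^sup>2 f(2s) ds\<close>, and \<open>f(2s) \<le> f(s)\<^sup>2 / f(0)\<close> by log-concavity. Here \<open>f(s) / f(0) \<le> 1/16\<close> for
  \<open>|s| \<ge> L = 8 S / f(0)\<close>, because \<open>f\<close> is decreasing and has mass \<open>S\<close>. So \<open>J \<le> 8 L\<^sup>2 S + J / 2\<close>.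
\<close>

lemma second_moment_upper:
  "(f 0)\<^sup>2 * (\<integral>t. t\<^sup>2 * f t \<partial>lborel) \<le> 1024 * (\<integral>t. f t \<partial>lborel) ^ 3"
proof (cases "f 0 = 0")
  case True
  then have "f t = 0" for t using max_at_0[of t] nonneg[of t] by simp
  then show ?thesis by simp
next
  case False
  let ?S = "\<integral>t. f t \<partial>lborel" and ?J = "\<integral>t. t\<^sup>2 * f t \<partial>lborel" and ?M = "f 0"
  have M: "?M > 0" using False nonneg[of 0] by simp
  have S: "?S \<ge> 0" using nonneg by simp
  have I: "integrable lborel f" by (rule bounded_supp1_integrable[OF supp])
  have I2: "integrable lborel (\<lambda>t. t\<^sup>2 * f t)" by (rule bounded_supp1_integrable[OF bounded_supp1_sq[OF supp]])
  define L where "L = 8 * ?S / ?M"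
  have L: "L \<ge> 0" using S M by (simp add: L_def)
  have small: "f L \<le> ?M / 16 \<or> ?S = 0"
  proof -
    have "(\<integral>t. f L * indicator {-L..L} t \<partial>lborel) \<le> ?S"
    proof (rule integral_mono)
      show "f L * indicator {-L..L} t \<le> f t" for t
      proof (cases "t \<in> {-L..L}")
        case True
        then have "f L \<le> f \<bar>t\<bar>" by (intro decreasing) auto
        also have "f \<bar>t\<bar> = f t" using even[of t] by (auto simp: abs_if)
        finally show ?thesis using True by simp
      qed (use nonneg in simp)
    qed (auto intro!: I integrable_real_indicator simp: emeasure_lborel_Icc_eq)
    then have "f L * (2 * L) \<le> ?S" using L by simp
    then have "?S * (f L * 16) \<le> ?S * ?M" using M by (simp add: L_def field_simps)
    then show ?thesis using S by (auto simp: mult_le_cancel_left)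
  qed
  show ?thesis
  proof (cases "?S = 0")
    case True
    then have "AE t in lborel. f t = 0" using integral_nonneg_eq_0_iff_AE[OF I] nonneg by simp
    then have "AE t in lborel. t\<^sup>2 * f t = 0" by eventually_elim simp
    then have "?J = 0" using integral_cong_AE[of "\<lambda>t. t\<^sup>2 * f t" lborel "\<lambda>_. 0"] I2 by simp
    then show ?thesis using True by simp
  next
    case False
    then have small: "f L \<le> ?M / 16" using small by simp
    have "?J = 2 * (\<integral>s. (0 + 2 * s)\<^sup>2 * f (0 + 2 * s) \<partial>lborel)"
      by (subst lborel_integral_real_affine[of 2 _ 0]) auto
    also have "\<dots> = 8 * (\<integral>s. s\<^sup>2 * f (2 * s) \<partial>lborel)"
      by (simp add: power_mult_distrib mult.assoc)
    also have "(\<integral>s. s\<^sup>2 * f (2 * s) \<partial>lborel) \<le> (\<integral>s. L\<^sup>2 * f s + (1 / 16) * (s\<^sup>2 * f s) \<partial>lborel)"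
    proof (rule integral_mono)
      have "integrable lborel (\<lambda>s. (0 + 2 * s)\<^sup>2 * f (0 + 2 * s))"
        by (rule lborel_integrable_real_affine[OF I2]) simp
      then have "integrable lborel (\<lambda>s. (1/4) * ((0 + 2 * s)\<^sup>2 * f (0 + 2 * s)))"
        by (rule integrable_mult_right)
      then show "integrable lborel (\<lambda>s. s\<^sup>2 * f (2 * s))" by (simp add: power_mult_distrib)
      show "integrable lborel (\<lambda>s. L\<^sup>2 * f s + (1 / 16) * (s\<^sup>2 * f s))" using I I2 by auto
      fix s
      have "?M * f (2 * s) \<le> (f s)\<^sup>2" using midpoint[of 0 "2 * s"] by simp
      then have "f (2 * s) \<le> (f s / ?M) * f s" using M by (simp add: field_simps power2_eq_square)
      then have 1: "s\<^sup>2 * f (2 * s) \<le> s\<^sup>2 * ((f s / ?M) * f s)" by (intro mult_left_mono) auto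
      have 2: "s\<^sup>2 * ((f s / ?M) * f s) \<le> L\<^sup>2 * f s + (1 / 16) * (s\<^sup>2 * f s)"
      proof (cases "\<bar>s\<bar> \<le> L")
        case True
        have "f s / ?M \<le> 1" using M max_at_0 by simp
        then have "s\<^sup>2 * ((f s / ?M) * f s) \<le> L\<^sup>2 * (1 * f s)"
          using True L M nonneg by (intro mult_mono) (auto simp: abs_le_square_iff[symmetric])
        moreover have "0 \<le> (1 / 16) * (s\<^sup>2 * f s)" using nonneg by simp
        ultimately show ?thesis by simp
      next
        case False
        have "f s = f \<bar>s\<bar>" using even[of s] by (auto simp: abs_if)
        also have "\<dots> \<le> f L" using False L by (intro decreasing) auto
        finally have "f s / ?M \<le> 1 / 16" using small M by (simp add: field_simps)
        then have "s\<^sup>2 * ((f s / ?M) * f s) \<le> s\<^sup>2 * ((1 / 16) * f s)"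
          using nonneg by (intro mult_left_mono mult_right_mono) auto
        moreover have "0 \<le> L\<^sup>2 * f s" using nonneg by simp
        ultimately show ?thesis by linarith
      qed
      show "s\<^sup>2 * f (2 * s) \<le> L\<^sup>2 * f s + (1 / 16) * (s\<^sup>2 * f s)" using 1 2 by linarith
    qed
    also have "(\<integral>s. L\<^sup>2 * f s + (1 / 16) * (s\<^sup>2 * f s) \<partial>lborel) = L\<^sup>2 * ?S + (1 / 16) * ?J"
      using I I2 by (subst Bochner_Integration.integral_add) auto
    finally have "?J \<le> 16 * L\<^sup>2 * ?S" by simp
    also have "\<dots> = 1024 * ?S ^ 3 / ?M\<^sup>2" by (simp add: L_def power2_eq_square power3_eq_cube)
    finally show ?thesis using M by (simp add: field_simps)
  qed
qed

end

section \<open>Sections of symmetric convex bodies\<close>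

text \<open>
  A frame measure is carried by the span of the frame. Testing the inclusion on points of the span
  avoids the question whether spans are measurable.
\<close>

lemma emeasure_frame_mono:
  assumes [measurable]: "X \<in> sets borel" "Y \<in> sets borel"
    and sub: "\<And>x. x \<in> span (b ` {..<d}) \<Longrightarrow> x \<in> X \<Longrightarrow> x \<in> Y"
  shows "emeasure (frame_measure d b) X \<le> emeasure (frame_measure d b) Y"
  unfolding frame_measure_def
  by (subst (1 2) emeasure_distr) (auto intro!: emeasure_mono sub comb_in_span)

lemma emeasure_frame_scale:
  assumes [measurable]: "X \<in> sets borel" and "s \<noteq> 0"
  shows "emeasure (frame_measure d b) X = ennreal (\<bar>s\<bar> ^ d) * emeasure (frame_measure d b) {x. s *\<^sub>R x \<in> X}"
proof -
  have "(\<integral>\<^sup>+x. indicator X (s *\<^sub>R x) \<partial>frame_measure d b) = (\<integral>\<^sup>+x. indicator {x. s *\<^sub>R x \<in> X} x \<partial>frame_measure d b)"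
    by (intro nn_integral_cong) (auto simp: indicator_def)
  then show ?thesis
    using nn_integral_frame_scale[of "indicator X" s d b] assms by simp
qed

lemma emeasure_frame_translate:
  assumes "orthonormal_seq (dot n) d b" "y \<in> span (b ` {..<d})" and [measurable]: "X \<in> sets borel"
  shows "emeasure (frame_measure d b) {x. x + y \<in> X} = emeasure (frame_measure d b) X"
proof -
  have "(\<integral>\<^sup>+x. indicator X (x + y) \<partial>frame_measure d b) = (\<integral>\<^sup>+x. indicator {x. x + y \<in> X} x \<partial>frame_measure d b)"
    by (intro nn_integral_cong) (auto simp: indicator_def)
  then show ?thesis
    using nn_integral_frame_translate[OF assms(1,2), of "indicator X"] by simp
qed

lemma continuous_on_dot: "continuous_on S (\<lambda>x. dot n x y)" "continuous_on S (\<lambda>x. dot n x x)"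
proof -
  have "continuous_on S (\<lambda>x :: nat \<Rightarrow> real. x i)" for i
    by (rule continuous_on_subset[OF continuous_on_product_coordinates subset_UNIV])
  then show "continuous_on S (\<lambda>x. dot n x y)" "continuous_on S (\<lambda>x. dot n x x)"
    unfolding dot_def by (auto intro!: continuous_on_sum continuous_on_mult continuous_on_const)
qed

locale sym_body =
  fixes n :: nat and K :: "(nat \<Rightarrow> real) set"
  assumes Rn: "K \<subseteq> Rn n" and compact: "compact K" and convex: "convex K"
    and sym: "x \<in> K \<Longrightarrow> - x \<in> K"
    and ball: "\<exists>r>0. \<forall>x\<in>Rn n. dot n x x \<le> r\<^sup>2 \<longrightarrow> x \<in> K"
begin

sublocale E: inner_form n "dot n" by (rule inner_form_dot)

lemma borel [measurable]: "K \<in> sets borel"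
  by (intro borel_closed compact_imp_closed compact)

lemma zero_mem: "0 \<in> K"
proof -
  obtain r where "r > 0" "\<forall>x\<in>Rn n. dot n x x \<le> r\<^sup>2 \<longrightarrow> x \<in> K" using ball by blast
  then show ?thesis using subspace_0[OF subspace_Rn] by auto
qed

lemma convex_mem: "x \<in> K \<Longrightarrow> y \<in> K \<Longrightarrow> 0 \<le> u \<Longrightarrow> 0 \<le> v \<Longrightarrow> u + v = 1 \<Longrightarrow> u *\<^sub>R x + v *\<^sub>R y \<in> K"
  by (rule convexD[OF convex])

lemma scale_mem:
  assumes "x \<in> K" "\<bar>s\<bar> \<le> 1"
  shows "s *\<^sub>R x \<in> K"
proof -
  have "s *\<^sub>R x \<in> K" if "x \<in> K" "0 \<le> s" "s \<le> 1" for x s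
    using convex_mem[OF that(1) zero_mem, of s "1 - s"] that by simp
  from this[of x s] this[of "- x" "- s"] show ?thesis
    using sym[OF assms(1)] assms by (cases "s \<ge> 0") auto
qed

lemma comb_mem:
  assumes "x \<in> K" "y \<in> K" "\<bar>s\<bar> + \<bar>t\<bar> \<le> 1"
  shows "s *\<^sub>R x + t *\<^sub>R y \<in> K"
proof (cases "s = 0")
  case True
  then show ?thesis using scale_mem assms by simp
next
  case False
  define r where "r = \<bar>s\<bar> + \<bar>t\<bar>"
  have r: "r > 0" "r \<le> 1" using False assms by (auto simp: r_def)
  have "(\<bar>s\<bar> / r) *\<^sub>R (sgn s *\<^sub>R x) + (\<bar>t\<bar> / r) *\<^sub>R (sgn t *\<^sub>R y) \<in> K"
  proof (rule convex_mem)
    show "sgn s *\<^sub>R x \<in> K" "sgn t *\<^sub>R y \<in> K"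
      using assms(1,2) by (auto intro!: scale_mem simp: abs_sgn_eq)
    show "\<bar>s\<bar> / r + \<bar>t\<bar> / r = 1" using r(1) by (simp add: r_def add_divide_distrib[symmetric])
  qed (use r in auto)
  from scale_mem[OF this, of r] r show ?thesis
    by (simp add: scaleR_add_right abs_mult_sgn)
qed

lemma bounded: "\<exists>R>0. \<forall>x\<in>K. dot n x x \<le> R\<^sup>2"
proof -
  have "compact ((\<lambda>x. dot n x x) ` K)"
    using compact continuous_on_dot(2) by (intro compact_continuous_image)
  then have "bdd_above ((\<lambda>x. dot n x x) ` K)"
    by (intro bounded_imp_bdd_above compact_imp_bounded)
  then obtain M where M: "\<And>x. x \<in> K \<Longrightarrow> dot n x x \<le> M"
    unfolding bdd_above_def by blast
  have "\<bar>M\<bar> \<le> (\<bar>M\<bar> + 1)\<^sup>2" by (simp add: power2_eq_square algebra_simps)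
  then have "dot n x x \<le> (\<bar>M\<bar> + 1)\<^sup>2" if "x \<in> K" for x using M[OF that] by linarith
  then show ?thesis by (intro exI[of _ "\<bar>M\<bar> + 1"]) auto
qed

definition vol :: "nat \<Rightarrow> (nat \<Rightarrow> nat \<Rightarrow> real) \<Rightarrow> real"
  where "vol d b = measure (frame_measure d b) K"

lemma emeasure_finite:
  assumes "orthonormal_seq (dot n) d b" and [measurable]: "X \<in> sets borel"
    and "\<And>x. x \<in> X \<Longrightarrow> dot n x x \<le> R"
  shows "emeasure (frame_measure d b) X < \<infinity>"
proof -
  have "emeasure (frame_measure d b) X \<le> emeasure (frame_measure d b) {x. dot n x x \<le> R}"
    by (rule emeasure_frame_mono) (use assms(3) in auto)
  then show ?thesis using frame_ball_finite[OF assms(1), of R] by (rule le_less_trans)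
qed

lemma emeasure_vol:
  assumes "orthonormal_seq (dot n) d b"
  shows "emeasure (frame_measure d b) K = ennreal (vol d b)"
proof -
  obtain R where "\<forall>x\<in>K. dot n x x \<le> R\<^sup>2" using bounded by blast
  then have "emeasure (frame_measure d b) K < \<infinity>"
    using emeasure_finite[OF assms borel, of "R\<^sup>2"] by blast
  then show ?thesis unfolding vol_def by (intro emeasure_eq_ennreal_measure) auto
qed

lemma vol_pos:
  assumes "orthonormal_seq (dot n) d b" "b ` {..<d} \<subseteq> Rn n"
  shows "vol d b > 0"
proof -
  obtain r where r: "r > 0" "\<forall>x\<in>Rn n. dot n x x \<le> r\<^sup>2 \<longrightarrow> x \<in> K" using ball by blast
  have "emeasure (frame_measure d b) {x. dot n x x \<le> r\<^sup>2} \<le> emeasure (frame_measure d b) K"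
  proof (rule emeasure_frame_mono)
    fix x assume "x \<in> span (b ` {..<d})" "x \<in> {x. dot n x x \<le> r\<^sup>2}"
    then show "x \<in> K" using r(2) span_minimal[OF assms(2) subspace_Rn] by blast
  qed auto
  moreover have "0 < emeasure (frame_measure d b) {x. dot n x x \<le> r\<^sup>2}"
    using r(1) by (intro frame_ball_positive[OF assms(1)]) simp
  ultimately have "0 < ennreal (vol d b)"
    unfolding emeasure_vol[OF assms(1)] by (rule less_le_trans[rotated])
  then show ?thesis by simp
qed

lemma bounded_supp_indicator:
  assumes "orthonormal_seq (dot n) d b"
  shows "bounded_supp d (\<lambda>c. indicator K (\<Sum>i<d. c i *\<^sub>R b i))"
proof -
  obtain R where R: "R > 0" "\<And>x. x \<in> K \<Longrightarrow> dot n x x \<le> R\<^sup>2" using bounded by blast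
  have "\<bar>c i\<bar> \<le> R" if "(\<Sum>i<d. c i *\<^sub>R b i) \<in> K" "i < d" for c i
  proof -
    have "(c i)\<^sup>2 \<le> (\<Sum>i<d. (c i)\<^sup>2)" using that by (intro member_le_sum) auto
    also have "\<dots> \<le> R\<^sup>2" using R(2)[OF that(1)] E.comb_self[OF assms, of c] by simp
    finally show ?thesis using R(1) by (simp add: abs_le_square_iff[symmetric])
  qed
  then show ?thesis unfolding bounded_supp_def
    by (intro conjI exI[of _ 1] exI[of _ R]) (measurable, auto simp: indicator_def)
qed

lemma vol_eq_integral:
  shows "vol d b = (\<integral>c. indicator K (\<Sum>i<d. c i *\<^sub>R b i) \<partial>coord_measure d)"
proof -
  have "vol d b = (\<integral>x. indicator K x \<partial>frame_measure d b)" by (simp add: vol_def)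
  also have "\<dots> = (\<integral>c. indicator K (\<Sum>i<d. c i *\<^sub>R b i) \<partial>coord_measure d)"
    unfolding frame_measure_def by (subst integral_distr) auto
  finally show ?thesis .
qed

definition sect :: "nat \<Rightarrow> (nat \<Rightarrow> nat \<Rightarrow> real) \<Rightarrow> real \<Rightarrow> real"
  where "sect m b t = measure (frame_measure m b) {x. x + t *\<^sub>R b m \<in> K}"

lemma sect_0: "sect m b 0 = vol m b"
  by (simp add: sect_def vol_def)

lemma comb_upd: "(\<Sum>i<Suc m. (c(m := t)) i *\<^sub>R b i) = (\<Sum>i<m. c i *\<^sub>R b i) + t *\<^sub>R (b m :: nat \<Rightarrow> real)"
  by (auto intro!: sum.cong)

lemma sect_eq_integral:
  "sect m b t = (\<integral>c. indicator K (\<Sum>i<Suc m. (c(m := t)) i *\<^sub>R b i) \<partial>coord_measure m)"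
proof -
  have "sect m b t = (\<integral>x. indicator {x. x + t *\<^sub>R b m \<in> K} x \<partial>frame_measure m b)" by (simp add: sect_def)
  also have "\<dots> = (\<integral>c. indicator {x. x + t *\<^sub>R b m \<in> K} (\<Sum>i<m. c i *\<^sub>R b i) \<partial>coord_measure m)"
    unfolding frame_measure_def by (subst integral_distr) auto
  finally show ?thesis by (simp add: comb_upd indicator_def del: fun_upd_apply sum.lessThan_Suc)
qed

text \<open>
  Fubini's theorem and the Prekopa-Leindler inequality for the indicator function of \<open>K\<close>.
\<close>

lemma sect_props:
  assumes b: "orthonormal_seq (dot n) (Suc m) b"
  shows sect_even_log_concave: "even_log_concave (sect m b)"
    and sect_integral: "(\<integral>t. sect m b t \<partial>lborel) = vol (Suc m) b"
proof -
  note I = integral_coord_Suc[OF bounded_supp_indicator[OF b], folded sect_eq_integral]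
  show "(\<integral>t. sect m b t \<partial>lborel) = vol (Suc m) b"
    unfolding vol_eq_integral I(3) ..
  show "even_log_concave (sect m b)"
  proof
    show "bounded_supp1 (sect m b)" by (rule I(2))
    fix t
    have s: "{x. x + (- t) *\<^sub>R b m \<in> K} \<in> sets borel" by measurable
    have "emeasure (frame_measure m b) {x. x + (- t) *\<^sub>R b m \<in> K}
        = emeasure (frame_measure m b) {x. (-1) *\<^sub>R x \<in> {x. x + (- t) *\<^sub>R b m \<in> K}}"
      using emeasure_frame_scale[OF s, of "-1" m b] by simp
    also have "{x. (-1) *\<^sub>R x \<in> {x. x + (- t) *\<^sub>R b m \<in> K}} = {x. x + t *\<^sub>R b m \<in> K}"
    proof -
      have "- x - t *\<^sub>R b m \<in> K \<longleftrightarrow> x + t *\<^sub>R b m \<in> K" for x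
        using sym[of "x + t *\<^sub>R b m"] sym[of "- x - t *\<^sub>R b m"] by (auto simp: algebra_simps)
      then show ?thesis by simp
    qed
    finally show "sect m b (- t) = sect m b t" unfolding sect_def measure_def by (simp only:)
  next
    fix \<theta> s t :: real assume th: "0 < \<theta>" "\<theta> < 1"
    show "sect m b s powr (1 - \<theta>) * sect m b t powr \<theta> \<le> sect m b ((1 - \<theta>) * s + \<theta> * t)"
      unfolding sect_eq_integral
    proof (rule prekopa_leindler[OF th I(1) I(1) I(1)])
      fix x y :: "nat \<Rightarrow> real"
      let ?X = "\<lambda>x t. (\<Sum>i<Suc m. (x(m := t)) i *\<^sub>R b i)"
      have "?X ((1 - \<theta>) *\<^sub>R x + \<theta> *\<^sub>R y) ((1 - \<theta>) * s + \<theta> * t) = (1 - \<theta>) *\<^sub>R ?X x s + \<theta> *\<^sub>R ?X y t"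
        unfolding comb_upd
        by (simp add: fun_vec_simps(1) fun_vec_simps(3)[of _ x] fun_vec_simps(3)[of _ y] scaleR_add_left scaleR_add_right sum.distrib scaleR_sum_right)
      then show "indicator K (?X x s) powr (1 - \<theta>) * indicator K (?X y t) powr \<theta>
        \<le> (indicator K (?X ((1 - \<theta>) *\<^sub>R x + \<theta> *\<^sub>R y) ((1 - \<theta>) * s + \<theta> * t)) :: real)"
        using convex_mem[of "?X x s" "?X y t" "1 - \<theta>" \<theta>] th
        by (auto simp: indicator_def simp del: fun_upd_apply sum.lessThan_Suc)
    qed
  qed
qed

definition moment :: "nat \<Rightarrow> (nat \<Rightarrow> nat \<Rightarrow> real) \<Rightarrow> (nat \<Rightarrow> real) \<Rightarrow> (nat \<Rightarrow> real) \<Rightarrow> real"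
  where "moment d b y z = (\<integral>x. indicator K x * (dot n x y * dot n x z) \<partial>frame_measure d b)"

lemma sect_second_moment:
  assumes b: "orthonormal_seq (dot n) (Suc m) b"
  shows "(\<integral>t. t\<^sup>2 * sect m b t \<partial>lborel) = moment (Suc m) b (b m) (b m)"
proof -
  obtain C R where *: "(\<lambda>c. indicator K (\<Sum>i<Suc m. c i *\<^sub>R b i) :: real) \<in> borel_measurable (coord_measure (Suc m))"
    "\<And>c i. (indicator K (\<Sum>i<Suc m. c i *\<^sub>R b i) :: real) \<noteq> 0 \<Longrightarrow> i < Suc m \<Longrightarrow> \<bar>c i\<bar> \<le> R" "R \<ge> 0"
    using bounded_suppE[OF bounded_supp_indicator[OF b]] by metis
  let ?g = "\<lambda>c. indicator K (\<Sum>i<Suc m. c i *\<^sub>R b i) * (c m)\<^sup>2 :: real"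
  have g: "bounded_supp (Suc m) ?g"
  proof -
    have "0 \<le> ?g c \<and> ?g c \<le> R\<^sup>2 \<and> (?g c \<noteq> 0 \<longrightarrow> (\<forall>i<Suc m. \<bar>c i\<bar> \<le> R))" for c
    proof (cases "(\<Sum>i<Suc m. c i *\<^sub>R b i) \<in> K")
      case True
      then have "\<bar>c i\<bar> \<le> R" if "i < Suc m" for i using *(2)[of c i] that by simp
      then show ?thesis using True *(3) by (auto simp: abs_le_square_iff[symmetric] simp del: sum.lessThan_Suc)
    qed (simp del: sum.lessThan_Suc)
    moreover have "?g \<in> borel_measurable (coord_measure (Suc m))"
    proof (rule borel_measurable_times[OF *(1) borel_measurable_power])
      show "(\<lambda>c. c m) \<in> borel_measurable (coord_measure (Suc m))" by measurable
    qed
    ultimately show ?thesis unfolding bounded_supp_def by blast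
  qed
  have "moment (Suc m) b (b m) (b m) = (\<integral>c. indicator K (\<Sum>i<Suc m. c i *\<^sub>R b i) * (dot n (\<Sum>i<Suc m. c i *\<^sub>R b i) (b m) * dot n (\<Sum>i<Suc m. c i *\<^sub>R b i) (b m)) \<partial>coord_measure (Suc m))"
    unfolding moment_def frame_measure_def by (rule integral_distr[OF measurable_comb]) measurable
  also have "\<dots> = (\<integral>c. ?g c \<partial>coord_measure (Suc m))"
    using E.comb_right[OF b, of m] by (simp add: power2_eq_square del: sum.lessThan_Suc)
  also have "\<dots> = (\<integral>t. (\<integral>c. ?g (c(m := t)) \<partial>coord_measure m) \<partial>lborel)"
    by (rule integral_coord_Suc(3)[OF g])
  also have "\<dots> = (\<integral>t. t\<^sup>2 * sect m b t \<partial>lborel)"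
    unfolding sect_eq_integral by (intro Bochner_Integration.integral_cong) (auto simp del: sum.lessThan_Suc simp: mult.commute)
  finally show ?thesis ..
qed

lemma moment_integrable:
  assumes b: "orthonormal_seq (dot n) d b"
  shows "integrable (frame_measure d b) (\<lambda>x. indicator K x * (dot n x y * dot n x z))"
proof -
  have "compact ((\<lambda>x. dot n x y * dot n x z) ` K)"
    using compact continuous_on_dot(1) by (intro compact_continuous_image continuous_on_mult)
  then have "bounded ((\<lambda>x. dot n x y * dot n x z) ` K)" by (rule compact_imp_bounded)
  then obtain M where M: "\<And>x. x \<in> K \<Longrightarrow> \<bar>dot n x y * dot n x z\<bar> \<le> M"
    unfolding bounded_iff real_norm_def by blast
  show ?thesis
  proof (rule integrableI_bounded_set[of K])
    show "emeasure (frame_measure d b) K < \<infinity>" using emeasure_vol[OF b] by simp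
    show "AE x in frame_measure d b. x \<in> K \<longrightarrow> norm (indicator K x * (dot n x y * dot n x z)) \<le> M"
      using M by auto
  qed auto
qed

lemma moment_add: 
  assumes b: "orthonormal_seq (dot n) d b"
  shows "moment d b (x + y) z = moment d b x z + moment d b y z"
  unfolding moment_def
  by (subst Bochner_Integration.integral_add[symmetric])
     (auto intro: moment_integrable[OF b] simp: E.add_right algebra_simps)

lemma moment_scale: "moment d b (r *\<^sub>R x) z = r * moment d b x z"
  unfolding moment_def
  by (subst integral_mult_right_zero[symmetric]) (auto simp: E.scale_right algebra_simps intro!: Bochner_Integration.integral_cong)

lemma moment_sym: "moment d b x z = moment d b z x"
  unfolding moment_def by (simp add: mult.commute)

lemma moment_nonneg: "0 \<le> moment d b x x"
  unfolding moment_def by simp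

text \<open>
  For \<open>v = b\<^sub>m\<close> this says that the central section orthogonal to \<open>v\<close> is determined up to absolute
  constants by the volume and the second moment in the direction \<open>v\<close>.
\<close>

lemma hensley:
  assumes b: "orthonormal_seq (dot n) (Suc m) b"
  shows "vol (Suc m) b ^ 3 \<le> 32 * (vol m b)\<^sup>2 * moment (Suc m) b (b m) (b m)"
    and "(vol m b)\<^sup>2 * moment (Suc m) b (b m) (b m) \<le> 1024 * vol (Suc m) b ^ 3"
  using even_log_concave.second_moment_lower[OF sect_even_log_concave[OF b]]
    even_log_concave.second_moment_upper[OF sect_even_log_concave[OF b]]
  unfolding sect_integral[OF b] sect_second_moment[OF b] sect_0 by auto

text \<open>
  By convexity, \<open>K\<close> contains the cone over its section \<open>K \<inter> F\<close> with apex \<open>t\<^sub>0 b\<^sub>m + y\<close>, where \<open>F\<close> is the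
  span of the first \<open>m\<close> vectors. For \<open>0 \<le> t \<le> t\<^sub>0 / 2\<close>, its slice at height \<open>t\<close> contains a translate
  of \<open>(K \<inter> F) / 2\<close>.
\<close>

lemma vol_cone_lower:
  assumes b: "orthonormal_seq (dot n) (Suc m) b"
    and t0: "t0 > 0" and y: "y \<in> span (b ` {..<m})" "t0 *\<^sub>R b m + y \<in> K"
  shows "t0 * vol m b \<le> 2 ^ Suc m * vol (Suc m) b"
proof -
  have bm: "orthonormal_seq (dot n) m b" using orthonormal_seq_mono[OF b] by simp
  interpret S: even_log_concave "sect m b" by (rule sect_even_log_concave[OF b])
  have fin: "emeasure (frame_measure m b) {x. x + t *\<^sub>R b m \<in> K} = ennreal (sect m b t)" for t
  proof -
    obtain R where R: "R > 0" "\<And>x. x \<in> K \<Longrightarrow> dot n x x \<le> R\<^sup>2" using bounded by blast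
    have "emeasure (frame_measure m b) {x. x + t *\<^sub>R b m \<in> K} \<le> emeasure (frame_measure m b) {x. dot n x x \<le> R\<^sup>2}"
    proof (rule emeasure_frame_mono)
      fix x assume x: "x \<in> span (b ` {..<m})" "x \<in> {x. x + t *\<^sub>R b m \<in> K}"
      have "dot n x (b m) = (\<Sum>i<m. dot n x (b i) * dot n (b i) (b m))"
        by (subst E.span_comb[OF bm x(1)]) (simp add: E.sum_left E.scale_left)
      also have "\<dots> = 0" by (auto intro!: sum.neutral simp: orthonormal_seqD[OF b])
      finally have "dot n x (b m) = 0" .
      then have "dot n (x + t *\<^sub>R b m) (x + t *\<^sub>R b m) = dot n x x + t * t * dot n (b m) (b m)"
        by (simp add: E.add_left E.add_right E.scale_left E.scale_right E.sym[of "b m" x])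
      moreover have "dot n (b m) (b m) = 1" by (simp add: orthonormal_seqD[OF b])
      moreover have "dot n (x + t *\<^sub>R b m) (x + t *\<^sub>R b m) \<le> R\<^sup>2" using R(2) x(2) by simp
      ultimately have "dot n x x + t * t \<le> R\<^sup>2" by simp
      then have "dot n x x \<le> R\<^sup>2" using zero_le_square[of t] by linarith
      then show "x \<in> {x. dot n x x \<le> R\<^sup>2}" by simp
    qed measurable
    also have "\<dots> < \<infinity>" by (rule frame_ball_finite[OF bm])
    finally show ?thesis unfolding sect_def by (intro emeasure_eq_ennreal_measure) auto
  qed
  have low: "vol m b \<le> 2 ^ m * sect m b t" if "0 \<le> t" "t \<le> t0 / 2" for t
  proof -
    define \<theta> where "\<theta> = t / t0"
    have th: "0 \<le> \<theta>" "\<theta> \<le> 1/2" "\<theta> * t0 = t" using that t0 by (auto simp: \<theta>_def field_simps)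
    have ysp: "- \<theta> *\<^sub>R y \<in> span (b ` {..<m})" using y span_scale span_neg by blast
    have "emeasure (frame_measure m b) K = ennreal (2 ^ m) * emeasure (frame_measure m b) {x. 2 *\<^sub>R x \<in> K}"
      using emeasure_frame_scale[OF borel, of 2 m b] by simp
    also have "emeasure (frame_measure m b) {x. 2 *\<^sub>R x \<in> K} = emeasure (frame_measure m b) {x. x + (- \<theta> *\<^sub>R y) \<in> {x. 2 *\<^sub>R x \<in> K}}"
      by (rule emeasure_frame_translate[OF bm ysp, symmetric]) measurable
    also have "\<dots> \<le> emeasure (frame_measure m b) {x. x + t *\<^sub>R b m \<in> K}"
    proof (rule emeasure_frame_mono)
      fix x assume "x \<in> {x. x + (- \<theta> *\<^sub>R y) \<in> {x. 2 *\<^sub>R x \<in> K}}"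
      then have "2 *\<^sub>R (x + (- \<theta> *\<^sub>R y)) \<in> K" by simp
      from comb_mem[OF this y(2), of "1/2" \<theta>] th
      have "(1/2) *\<^sub>R (2 *\<^sub>R (x + (- \<theta> *\<^sub>R y))) + \<theta> *\<^sub>R (t0 *\<^sub>R b m + y) \<in> K" by simp
      moreover have "(1/2) *\<^sub>R (2 *\<^sub>R (x + (- \<theta> *\<^sub>R y))) + \<theta> *\<^sub>R (t0 *\<^sub>R b m + y) = x + t *\<^sub>R b m"
        using th(3) by (simp add: scaleR_add_right)
      ultimately show "x \<in> {x. x + t *\<^sub>R b m \<in> K}" by (simp only: mem_Collect_eq)
    qed measurable
    finally show ?thesis unfolding emeasure_vol[OF bm] fin
      using S.nonneg[of t] by (simp add: ennreal_mult[symmetric] ennreal_le_iff mult_left_mono)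
  qed
  have "(\<integral>t. vol m b * indicator {0..t0/2} t \<partial>lborel) \<le> (\<integral>t. 2 ^ m * sect m b t \<partial>lborel)"
  proof (rule integral_mono)
    show "integrable lborel (\<lambda>t. 2 ^ m * sect m b t)" using bounded_supp1_integrable[OF S.supp] by simp
    show "vol m b * indicator {0..t0/2} t \<le> 2 ^ m * sect m b t" for t
      using low[of t] S.nonneg[of t] by (auto simp: indicator_def)
  qed (auto intro!: integrable_real_indicator simp: emeasure_lborel_Icc_eq)
  then show ?thesis using t0 by (simp add: sect_integral[OF b] field_simps)
qed

text \<open>
  If a slice of \<open>K\<close> parallel to \<open>K \<inter> F\<close> contains a point \<open>p\<close>, then half the difference of any of its
  points and \<open>p\<close> lies in \<open>K \<inter> F\<close>. So the volume of the slice is at most \<open>2\<^sup>m |K \<inter> F|\<close>.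
\<close>

lemma vol_slab_upper:
  assumes b: "orthonormal_seq (dot n) (Suc m) b"
    and w: "w \<ge> 0" "\<And>x. x \<in> K \<Longrightarrow> x \<in> span (b ` {..<Suc m}) \<Longrightarrow> \<bar>dot n x (b m)\<bar> \<le> w"
  shows "vol (Suc m) b \<le> 2 ^ Suc m * w * vol m b"
proof -
  have bm: "orthonormal_seq (dot n) m b" using orthonormal_seq_mono[OF b] by simp
  interpret S: even_log_concave "sect m b" by (rule sect_even_log_concave[OF b])
  have vn: "vol m b \<ge> 0" by (simp add: vol_def)
  have span_Suc: "x + t *\<^sub>R b m \<in> span (b ` {..<Suc m})" if "x \<in> span (b ` {..<m})" for x t
  proof (intro span_add span_scale)
    have "span (b ` {..<m}) \<subseteq> span (b ` {..<Suc m})" by (intro span_mono image_mono) auto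
    then show "x \<in> span (b ` {..<Suc m})" using that by blast
  qed (auto intro: span_base)
  have orth: "dot n (x + t *\<^sub>R b m) (b m) = t" if x: "x \<in> span (b ` {..<m})" for x t
  proof -
    have "dot n x (b m) = (\<Sum>i<m. dot n x (b i) * dot n (b i) (b m))"
      by (subst E.span_comb[OF bm x]) (simp add: E.sum_left E.scale_left)
    also have "\<dots> = 0" by (auto intro!: sum.neutral simp: orthonormal_seqD[OF b])
    finally show ?thesis by (simp add: E.add_left E.scale_left orthonormal_seqD[OF b])
  qed
  have up: "sect m b t \<le> 2 ^ m * vol m b * indicator {-w..w} t" for t
  proof (cases "\<exists>p \<in> span (b ` {..<m}). p + t *\<^sub>R b m \<in> K")
    case False
    then have "emeasure (frame_measure m b) {x. x + t *\<^sub>R b m \<in> K} \<le> emeasure (frame_measure m b) {}"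
      by (intro emeasure_frame_mono) auto
    then have "sect m b t = 0" by (simp add: sect_def measure_def)
    then show ?thesis using vn by simp
  next
    case True
    then obtain p where p: "p \<in> span (b ` {..<m})" "p + t *\<^sub>R b m \<in> K" by auto
    have tw: "t \<in> {-w..w}" using w(2)[OF p(2) span_Suc[OF p(1)]] orth[OF p(1)] by auto
    have psp: "- p \<in> span (b ` {..<m})" using p span_neg by blast
    have "emeasure (frame_measure m b) {x. x + t *\<^sub>R b m \<in> K} \<le> emeasure (frame_measure m b) {x. x + - p \<in> {x. (1/2) *\<^sub>R x \<in> K}}"
    proof (rule emeasure_frame_mono)
      fix x assume "x \<in> {x. x + t *\<^sub>R b m \<in> K}"
      then have "x + t *\<^sub>R b m \<in> K" by simp
      from comb_mem[OF this p(2), of "1/2" "-1/2"]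
      have "(1/2) *\<^sub>R (x + t *\<^sub>R b m) + (-1/2) *\<^sub>R (p + t *\<^sub>R b m) \<in> K" by simp
      moreover have "(1/2) *\<^sub>R (x + t *\<^sub>R b m) + (-1/2) *\<^sub>R (p + t *\<^sub>R b m) = (1/2) *\<^sub>R (x + - p)"
        by (simp add: scaleR_add_right scaleR_diff_right)
      ultimately show "x \<in> {x. x + - p \<in> {x. (1/2) *\<^sub>R x \<in> K}}" by simp
    qed measurable
    also have "\<dots> = emeasure (frame_measure m b) {x. (1/2) *\<^sub>R x \<in> K}"
      by (rule emeasure_frame_translate[OF bm psp]) measurable
    also have "\<dots> = ennreal (2 ^ m) * emeasure (frame_measure m b) {x. 2 *\<^sub>R x \<in> {x. (1/2) *\<^sub>R x \<in> K}}"
      using emeasure_frame_scale[of "{x. (1/2) *\<^sub>R x \<in> K}" 2 m b] by simp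
    also have "\<dots> = ennreal (2 ^ m) * ennreal (vol m b)" by (simp add: emeasure_vol[OF bm])
    also have "\<dots> = ennreal (2 ^ m * vol m b)" using vn by (simp add: ennreal_mult[symmetric])
    finally have "sect m b t \<le> 2 ^ m * vol m b"
      unfolding sect_def measure_def using vn by (intro enn2real_leI) auto
    then show ?thesis using tw by simp
  qed
  have "vol (Suc m) b = (\<integral>t. sect m b t \<partial>lborel)" by (rule sect_integral[OF b, symmetric])
  also have "\<dots> \<le> (\<integral>t. 2 ^ m * vol m b * indicator {-w..w} t \<partial>lborel)"
  proof (rule integral_mono)
    show "integrable lborel (sect m b)" by (rule bounded_supp1_integrable[OF S.supp])
    show "integrable lborel (\<lambda>t. 2 ^ m * vol m b * indicator {-w..w} t)"
      by (auto intro!: integrable_real_indicator simp: emeasure_lborel_Icc_eq)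
  qed (rule up)
  also have "\<dots> = 2 ^ Suc m * w * vol m b" using w(1) by simp
  finally show ?thesis .
qed

end

section \<open>Intersection bodies and the Banach-Mazur distance\<close>

lemma span_tail:
  assumes w: "orthonormal_seq (dot n) n w" "w ` {..<n} \<subseteq> Rn n" and "m \<le> n"
  shows "span (w ` {m..<n}) = {x \<in> Rn n. \<forall>i<m. dot n x (w i) = 0}"
proof -
  interpret inner_form n "dot n" by (rule inner_form_dot)
  have sub: "w ` {m..<n} \<subseteq> Rn n" using w(2) by auto
  show ?thesis
  proof (intro set_eqI iffI)
    fix x assume x: "x \<in> span (w ` {m..<n})"
    have "dot n x (w i) = 0" if "i < m" for i
      using x
    proof (induction rule: span_induct_alt)
      case (step c y z)
      then show ?case using orthonormal_seqD[OF w(1)] that \<open>m \<le> n\<close> by (auto simp: add_left scale_left)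
    qed simp
    then show "x \<in> {x \<in> Rn n. \<forall>i<m. dot n x (w i) = 0}"
      using x span_minimal[OF sub subspace_Rn] by auto
  next
    fix x assume x: "x \<in> {x \<in> Rn n. \<forall>i<m. dot n x (w i) = 0}"
    then have "x \<in> span (w ` {..<n})" using orthonormal_span_Rn[OF w] by auto
    then have "x = (\<Sum>i<n. dot n x (w i) *\<^sub>R w i)" by (rule span_comb[OF w(1)])
    also have "\<dots> = (\<Sum>i\<in>{m..<n}. dot n x (w i) *\<^sub>R w i)"
      using x by (intro sum.mono_neutral_right) (auto simp: not_less)
    also have "\<dots> \<in> span (w ` {m..<n})" by (intro span_sum span_scale span_base) auto
    finally show "x \<in> span (w ` {m..<n})" .
  qed
qed

lemma shift_image: "(\<lambda>i. w (k + i)) ` {..<n - k} = w ` {k..<n :: nat}"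
proof -
  have "(\<lambda>i. w (k + i)) ` {..<n - k} = w ` ((+) k ` {..<n - k})" by auto
  also have "(+) k ` {..<n - k} = {k..<n}" by (cases "k \<le> n") (auto simp: lessThan_atLeast0 image_add_atLeastLessThan)
  finally show ?thesis .
qed

lemma orthonormal_shift:
  assumes "orthonormal_seq B n w"
  shows "orthonormal_seq B (n - k) (\<lambda>i. w (k + i))"
  using assms by (auto simp: orthonormal_seq_def)

lemma orth_compl_tail:
  assumes w: "orthonormal_seq (dot n) n w" "w ` {..<n} \<subseteq> Rn n" and "k \<le> n"
  shows "orth_compl n (span ((\<lambda>i. w (k + i)) ` {..<n - k})) = span (w ` {..<k})"
proof -
  interpret inner_form n "dot n" by (rule inner_form_dot)
  have sub: "w ` {..<k} \<subseteq> Rn n" using w(2) \<open>k \<le> n\<close> by auto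
  show ?thesis unfolding shift_image
  proof (intro set_eqI iffI)
    fix x assume x: "x \<in> orth_compl n (span (w ` {k..<n}))"
    then have x0: "dot n x (w i) = 0" if "i \<in> {k..<n}" for i
      using that span_base[of "w i" "w ` {k..<n}"] by (auto simp: orth_compl_def)
    have "x \<in> span (w ` {..<n})" using x orthonormal_span_Rn[OF w] by (auto simp: orth_compl_def)
    then have "x = (\<Sum>i<n. dot n x (w i) *\<^sub>R w i)" by (rule span_comb[OF w(1)])
    also have "\<dots> = (\<Sum>i<k. dot n x (w i) *\<^sub>R w i)"
      using x0 \<open>k \<le> n\<close> by (intro sum.mono_neutral_right) (auto simp: not_less)
    also have "\<dots> \<in> span (w ` {..<k})" by (rule comb_in_span)
    finally show "x \<in> span (w ` {..<k})" .
  next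
    fix x assume x: "x \<in> span (w ` {..<k})"
    have "dot n x y = 0" if "y \<in> span (w ` {k..<n})" for y
      using x
    proof (induction rule: span_induct_alt)
      case (step c z z')
      then obtain i where i: "i < k" "z = w i" by auto
      then show ?case using step span_tail[OF w \<open>k \<le> n\<close>] that
        by (auto simp: add_left scale_left sym[of "w i" y])
    qed simp
    then show "x \<in> orth_compl n (span (w ` {k..<n}))"
      using x span_minimal[OF sub subspace_Rn] by (auto simp: orth_compl_def)
  qed
qed

text \<open>
  The basis chosen in the definition of the volume can be replaced by any orthonormal basis.
\<close>

lemma sub_vol_eq_frame:
  assumes b: "orthonormal_seq (dot n) d b" and [measurable]: "A \<in> sets borel"
    and E: "E = span (b ` {..<d})"
  shows "sub_vol n E (A \<inter> E) = measure (frame_measure d b) A"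
proof -
  interpret inner_form n "dot n" by (rule inner_form_dot)
  have dE: "dim E = d" using orthonormal_dim[OF b] E by simp
  define b' where "b' = (SOME b. orthonormal_basis n E b)"
  have "orthonormal_basis n E b" unfolding orthonormal_basis_def dE
    using b E by (auto simp: orthonormal_seq_def)
  then have "orthonormal_basis n E b'" unfolding b'_def by (rule someI[where P = "orthonormal_basis n E"])
  then have b': "orthonormal_seq (dot n) d b'" "span (b' ` {..<d}) = E"
    unfolding orthonormal_basis_def dE orthonormal_seq_def by auto
  have "{c \<in> {..<d} \<rightarrow>\<^sub>E UNIV. (\<Sum>i<d. c i *\<^sub>R b' i) \<in> A \<inter> E}
      = (\<lambda>c. \<Sum>i<d. c i *\<^sub>R b' i) -` A \<inter> space (coord_measure d)"
    using comb_in_span[of _ b' d] unfolding b'(2) by (auto simp: space_PiM)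
  then have "sub_vol n E (A \<inter> E) = measure (frame_measure d b') A"
    unfolding sub_vol_def Let_def b'_def[symmetric] dE frame_measure_def
    by (subst measure_distr) auto
  also have "frame_measure d b' = frame_measure d b"
    using frame_measure_unique[OF b'(1) b] b'(2) E by simp
  finally show ?thesis .
qed

text \<open>
  The defining property of the intersection body in the form used below: the first \<open>k\<close> vectors
  of an orthonormal basis span a subspace, the other \<open>n - k\<close> its orthogonal complement.
\<close>

lemma intersection_body_frames:
  assumes I: "is_intersection_body n k K D" and [measurable]: "K \<in> sets borel" "D \<in> sets borel"
    and w: "orthonormal_seq (dot n) n w" "w ` {..<n} \<subseteq> Rn n"
  shows "measure (frame_measure k w) D = measure (frame_measure (n - k) (\<lambda>i. w (k + i))) K"
proof -
  interpret inner_form n "dot n" by (rule inner_form_dot)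
  have kn: "k \<le> n" using I by (simp add: is_intersection_body_def)
  define H where "H = span ((\<lambda>i. w (k + i)) ` {..<n - k})"
  have o: "orthonormal_seq (dot n) (n - k) (\<lambda>i. w (k + i))" by (rule orthonormal_shift[OF w(1)])
  have "H \<subseteq> Rn n" unfolding H_def using w(2) by (intro span_minimal subspace_Rn) auto
  moreover have "subspace H" "dim H = n - k"
    using orthonormal_dim[OF o] by (auto simp: H_def subspace_span)
  ultimately have "sub_vol n (orth_compl n H) (D \<inter> orth_compl n H) = sub_vol n H (K \<inter> H)"
    using I by (simp add: is_intersection_body_def)
  moreover have "sub_vol n H (K \<inter> H) = measure (frame_measure (n - k) (\<lambda>i. w (k + i))) K"
    by (rule sub_vol_eq_frame[OF o _ H_def]) simp
  moreover have "sub_vol n (orth_compl n H) (D \<inter> orth_compl n H) = measure (frame_measure k w) D"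
    using orth_compl_tail[OF w kn] unfolding H_def
    by (intro sub_vol_eq_frame orthonormal_seq_mono[OF w(1) kn]) auto
  ultimately show ?thesis by simp
qed

text \<open>
  The topology is the product topology on sequences, so a neighbourhood of 0 only contains a box
  in finitely many coordinates. In \<open>\<real>\<^sup>n\<close> this is enough for a Euclidean ball.
\<close>

lemma ball_of_interior:
  assumes "0 \<in> top_of_set (Rn n) interior_of X"
  shows "\<exists>r>0. \<forall>x\<in>Rn n. dot n x x \<le> r\<^sup>2 \<longrightarrow> x \<in> X"
proof -
  obtain U where U: "openin (top_of_set (Rn n)) U" "0 \<in> U" "U \<subseteq> X"
    using assms unfolding interior_of_def by blast
  then obtain V where V: "open V" "U = Rn n \<inter> V" unfolding openin_open by blast
  have "openin (product_topology (\<lambda>_. euclidean) UNIV) V"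
    using V(1) by (simp add: open_fun_def)
  then obtain Z where Z: "0 \<in> (\<Pi>\<^sub>E i\<in>UNIV. Z i)" "\<And>i. openin euclidean (Z i)" "(\<Pi>\<^sub>E i\<in>UNIV. Z i) \<subseteq> V"
    using product_topology_open_contains_basis[of "\<lambda>_. euclidean" UNIV V 0] U(2) V(2) by blast
  have Z0: "0 \<in> Z i" for i using Z(1) by (auto simp: PiE_def Pi_def zero_fun_apply)
  have "\<exists>e>0. \<forall>t::real. \<bar>t\<bar> \<le> e \<longrightarrow> t \<in> Z i" for i
  proof -
    have "open (Z i)" using Z(2) by simp
    then obtain e where "e > 0" "cball 0 e \<subseteq> Z i" using Z0[of i] open_contains_cball by blast
    then show ?thesis by (intro exI[of _ e]) (auto simp: cball_def dist_real_def)
  qed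
  then obtain e where e: "\<And>i. e i > 0" "\<And>i t::real. \<bar>t\<bar> \<le> e i \<Longrightarrow> t \<in> Z i" by metis
  define r where "r = Min (insert 1 (e ` {..<n}))"
  have r: "r > 0" "\<And>i. i < n \<Longrightarrow> r \<le> e i" unfolding r_def using e(1) by (auto intro: Min_le)
  have "x \<in> X" if x: "x \<in> Rn n" "dot n x x \<le> r\<^sup>2" for x
  proof -
    have "x i \<in> Z i" for i
    proof (cases "i < n")
      case True
      have "(x i)\<^sup>2 \<le> dot n x x" unfolding dot_def power2_eq_square
        using True by (intro member_le_sum[of i]) auto
      then have "(x i)\<^sup>2 \<le> r\<^sup>2" using x(2) by linarith
      then have "\<bar>x i\<bar> \<le> r" using r(1) by (simp add: abs_le_square_iff[symmetric])
      then show ?thesis using e(2) r(2)[OF True] by (meson order_trans)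
    next
      case False
      then show ?thesis using x(1) Z0 by (simp add: Rn_def)
    qed
    then have "x \<in> V" using Z(3) by (auto simp: PiE_def Pi_def)
    then show "x \<in> X" using U(3) V(2) x(1) by blast
  qed
  with r(1) show ?thesis by blast
qed

lemma sym_body_if_star_body:
  assumes "star_body n X" "symmetric X" "convex X"
  shows "sym_body n X"
proof
  show "X \<subseteq> Rn n" "compact X" "convex X" using assms by (auto simp: star_body_def)
  show "\<exists>r>0. \<forall>x\<in>Rn n. dot n x x \<le> r\<^sup>2 \<longrightarrow> x \<in> X"
    using assms by (intro ball_of_interior) (auto simp: star_body_def)
  fix x assume "x \<in> X"
  then have "- x \<in> uminus ` X" by (rule imageI)
  then show "- x \<in> X" using assms(2) unfolding symmetric_def by simp
qed

text \<open>
  The ellipsoid \<open>q \<le> 1\<close> is the image of the unit ball under the linear map that takes the standard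
  basis to a \<open>q\<close>-orthonormal one.
\<close>

lemma banach_mazur_le:
  assumes q: "inner_form n q" and C: "C1 > 0" "C2 > 0"
    and sub: "\<And>x. x \<in> D \<Longrightarrow> x \<in> Rn n \<and> q x x \<le> C1"
    and sup: "\<And>x. x \<in> Rn n \<Longrightarrow> q x x \<le> 1 \<Longrightarrow> (1 / C2) *\<^sub>R x \<in> D"
  shows "banach_mazur_dist n D (unit_ball n) \<le> sqrt C1 * C2"
proof -
  interpret inner_form n q by (rule q)
  interpret E: inner_form n "dot n" by (rule inner_form_dot)
  obtain b where b: "orthonormal_seq q n b" "b ` {..<n} \<subseteq> Rn n"
    using orthonormal_complete[of 0 b] by (auto simp: orthonormal_seq_def)
  have bspan: "span (b ` {..<n}) = Rn n" by (rule orthonormal_span_Rn[OF b])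
  define T where "T = (\<lambda>x :: nat \<Rightarrow> real. \<Sum>i<n. x i *\<^sub>R b i)"
  have lin: "linear T"
  proof (rule linearI)
    fix x y :: "nat \<Rightarrow> real" and r :: real
    show "T (x + y) = T x + T y" by (simp add: T_def plus_fun_apply scaleR_add_left sum.distrib)
    have "(r *\<^sub>R x) i = r * x i" for i by (simp add: scaleR_fun_def)
    then show "T (r *\<^sub>R x) = r *\<^sub>R T x" by (simp add: T_def scaleR_sum_right)
  qed
  have TR: "T x \<in> Rn n" for x using comb_in_span[of x b n] bspan by (simp add: T_def)
  have qT: "q (T x) (T x) = dot n x x" for x
    unfolding T_def comb_self[OF b(1)] by (simp add: dot_def power2_eq_square)
  have inj: "inj_on T (Rn n)"
  proof (rule inj_onI)
    fix x y assume xy: "x \<in> Rn n" "y \<in> Rn n" "T x = T y"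
    show "x = y"
    proof
      fix i show "x i = y i"
      proof (cases "i < n")
        case True
        then show ?thesis using xy(3) comb_right[OF b(1) True] by (metis T_def)
      next
        case False
        then show ?thesis using xy by (simp add: Rn_def)
      qed
    qed
  qed
  have surj: "y \<in> T ` Rn n" if "y \<in> Rn n" for y
  proof
    define x where "x = (\<lambda>i. if i < n then q y (b i) else 0)"
    show "x \<in> Rn n" by (simp add: x_def Rn_def)
    have "y = (\<Sum>i<n. q y (b i) *\<^sub>R b i)" using that bspan by (intro span_comb[OF b(1)]) simp
    also have "\<dots> = T x" unfolding T_def x_def by (intro sum.cong) auto
    finally show "y = T x" .
  qed
  have TGL: "T \<in> GL n" unfolding GL_def bij_betw_def
    using lin inj surj TR by auto
  have img: "T ` unit_ball n = {y \<in> Rn n. q y y \<le> 1}"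
  proof (intro set_eqI iffI)
    fix y assume "y \<in> T ` unit_ball n"
    then show "y \<in> {y \<in> Rn n. q y y \<le> 1}" using TR qT by (auto simp: unit_ball_def)
  next
    fix y assume y: "y \<in> {y \<in> Rn n. q y y \<le> 1}"
    then obtain x where x: "x \<in> Rn n" "y = T x" using surj by auto
    then have "x \<in> unit_ball n" using y qT[of x] by (simp add: unit_ball_def)
    then show "y \<in> T ` unit_ball n" using x by auto
  qed
  define a where "a = sqrt C1"
  have a: "a > 0" "a * a = C1" using C by (auto simp: a_def)
  let ?G = "\<lambda>T. {r. 0 < r \<and> (\<exists>a>0. D \<subseteq> (\<lambda>x. a *\<^sub>R x) ` T ` unit_ball n \<and> (\<lambda>x. a *\<^sub>R x) ` T ` unit_ball n \<subseteq> (\<lambda>x. r *\<^sub>R x) ` D)}"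
  have "a * C2 \<in> ?G T"
  proof (intro CollectI conjI exI[of _ a])
    show "D \<subseteq> (\<lambda>x. a *\<^sub>R x) ` T ` unit_ball n"
    proof
      fix x assume x: "x \<in> D"
      have "q ((1 / a) *\<^sub>R x) ((1 / a) *\<^sub>R x) \<le> 1"
        using sub[OF x] a C by (simp add: scale_left scale_right field_simps)
      moreover have "(1 / a) *\<^sub>R x \<in> Rn n" using sub[OF x] by (intro subspace_scale subspace_Rn) auto
      ultimately have "(1 / a) *\<^sub>R x \<in> T ` unit_ball n" unfolding img by simp
      moreover have "x = a *\<^sub>R ((1 / a) *\<^sub>R x)" using a by simp
      ultimately show "x \<in> (\<lambda>x. a *\<^sub>R x) ` T ` unit_ball n" by blast
    qed
    show "(\<lambda>x. a *\<^sub>R x) ` T ` unit_ball n \<subseteq> (\<lambda>x. (a * C2) *\<^sub>R x) ` D"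
    proof
      fix z assume "z \<in> (\<lambda>x. a *\<^sub>R x) ` T ` unit_ball n"
      then obtain y where y: "z = a *\<^sub>R y" "y \<in> Rn n" "q y y \<le> 1" unfolding img by auto
      have "z = (a * C2) *\<^sub>R ((1 / C2) *\<^sub>R y)" using C y by simp
      then show "z \<in> (\<lambda>x. (a * C2) *\<^sub>R x) ` D" using sup[OF y(2,3)] by blast
    qed
  qed (use a C in auto)
  moreover have "bdd_below (?G T)" by (intro bdd_belowI[of _ 0]) auto
  ultimately have "geom_dist D (T ` unit_ball n) \<le> a * C2" unfolding geom_dist_def by (rule cInf_lower)
  moreover have "banach_mazur_dist n D (unit_ball n) \<le> geom_dist D (T ` unit_ball n)"
    unfolding banach_mazur_dist_def
  proof (rule cINF_lower[OF _ TGL])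
    \<comment> \<open>If no factor is admissible for T, then the infimum is that of the empty set, an unspecified real number.\<close>
    have "geom_dist D (T ` unit_ball n) \<ge> min 0 (Inf {})" for T
    proof (cases "?G T = {}")
      case False
      then have "0 \<le> Inf (?G T)" by (intro cInf_greatest) auto
      then show ?thesis unfolding geom_dist_def by simp
    next
      case True
      show ?thesis unfolding geom_dist_def True by simp
    qed
    then show "bdd_below ((\<lambda>T. geom_dist D (T ` unit_ball n)) ` GL n)" by (intro bdd_belowI2)
  qed
  ultimately show ?thesis by (simp add: a_def)
qed

section \<open>Ellipsoids from projections\<close>

context sym_body
begin

definition proj_out :: "nat \<Rightarrow> (nat \<Rightarrow> nat \<Rightarrow> real) \<Rightarrow> (nat \<Rightarrow> real) \<Rightarrow> nat \<Rightarrow> real"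
  where "proj_out j u x = x - (\<Sum>i<j. dot n x (u i) *\<^sub>R u i)"

lemma proj_out_orth:
  assumes "orthonormal_seq (dot n) j u" "i < j"
  shows "dot n (proj_out j u x) (u i) = 0"
  using E.comb_right[OF assms] by (simp add: proj_out_def E.diff_left)

lemma proj_out_Rn:
  assumes "u ` {..<j} \<subseteq> Rn n" "x \<in> Rn n"
  shows "proj_out j u x \<in> Rn n"
  unfolding proj_out_def using assms
  by (intro subspace_diff subspace_sum subspace_scale subspace_Rn) auto

lemma exists_orthogonal_unit:
  assumes "orthonormal_seq (dot n) j u" "u ` {..<j} \<subseteq> Rn n" "j < n"
  obtains v where "v \<in> Rn n" "dot n v v = 1" "\<And>i. i < j \<Longrightarrow> dot n v (u i) = 0"
proof -
  obtain w where w: "\<And>i. i < j \<Longrightarrow> w i = u i" "orthonormal_seq (dot n) n w" "w ` {..<n} \<subseteq> Rn n"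
    using E.orthonormal_complete[OF assms(1,2)] by metis
  show ?thesis
  proof (rule that[of "w j"])
    show "w j \<in> Rn n" using w(3) assms(3) by auto
    show "dot n (w j) (w j) = 1" using orthonormal_seqD[OF w(2)] assms(3) by simp
    show "dot n (w j) (u i) = 0" if "i < j" for i
      using orthonormal_seqD[OF w(2), of j i] w(1)[OF that] assms(3) that by simp
  qed
qed

text \<open>
  The farthest point of \<open>K\<close> in a subspace is its own supporting functional: the scalar product with
  it is maximal there, by the Cauchy-Schwarz inequality. This replaces a separation theorem.
\<close>

lemma farthest_point:
  assumes u: "orthonormal_seq (dot n) j u" "u ` {..<j} \<subseteq> Rn n" "j < n"
  obtains e r where "r > 0" "e \<in> Rn n" "dot n e e = 1" "r *\<^sub>R e \<in> K"
    "\<And>i. i < j \<Longrightarrow> dot n e (u i) = 0"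
    "\<And>x. x \<in> K \<Longrightarrow> (\<And>i. i < j \<Longrightarrow> dot n x (u i) = 0) \<Longrightarrow> \<bar>dot n x e\<bar> \<le> r"
proof -
  define S where "S = K \<inter> (\<Inter>i<j. {x. dot n x (u i) = 0})"
  have "closed {x. dot n x (u i) = 0}" for i
    by (intro closed_Collect_eq continuous_on_dot continuous_on_const)
  then have cS: "compact S" unfolding S_def by (intro compact_Int_closed compact closed_INT) auto
  have "0 \<in> S" by (auto simp: S_def zero_mem)
  then obtain p where p: "p \<in> S" "\<And>x. x \<in> S \<Longrightarrow> dot n x x \<le> dot n p p"
    using continuous_attains_sup[OF cS _ continuous_on_dot(2)] by blast
  obtain v where v: "v \<in> Rn n" "dot n v v = 1" "\<And>i. i < j \<Longrightarrow> dot n v (u i) = 0"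
    using exists_orthogonal_unit[OF u] by metis
  obtain s where s: "s > 0" "\<And>x. x \<in> Rn n \<Longrightarrow> dot n x x \<le> s\<^sup>2 \<Longrightarrow> x \<in> K" using ball by blast
  have "s *\<^sub>R v \<in> K" using v by (intro s(2) subspace_scale subspace_Rn) (simp_all add: E.scale_left E.scale_right power2_eq_square)
  then have "s *\<^sub>R v \<in> S" unfolding S_def using v by (auto simp: E.scale_left)
  from p(2)[OF this] have "s\<^sup>2 \<le> dot n p p" using v by (simp add: E.scale_left E.scale_right power2_eq_square)
  then have pp: "dot n p p > 0" using s(1) zero_less_power[of s 2] by linarith
  define r where "r = sqrt (dot n p p)"
  have r: "r > 0" "r * r = dot n p p" using pp by (auto simp: r_def)
  define e where "e = (1 / r) *\<^sub>R p"
  have pK: "p \<in> K" using p(1) by (simp add: S_def)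
  have ee: "dot n e e = 1" using r pp by (simp add: e_def E.scale_left E.scale_right field_simps)
  show ?thesis
  proof (rule that[of r e])
    show "r > 0" by (rule r)
    show "e \<in> Rn n" unfolding e_def using pK Rn by (intro subspace_scale subspace_Rn) auto
    show "dot n e e = 1" by (rule ee)
    show "r *\<^sub>R e \<in> K" using pK r by (simp add: e_def)
    show "dot n e (u i) = 0" if "i < j" for i using p(1) that by (simp add: e_def E.scale_left S_def)
    fix x assume x: "x \<in> K" "\<And>i. i < j \<Longrightarrow> dot n x (u i) = 0"
    then have "x \<in> S" by (simp add: S_def)
    then have "dot n x x \<le> r * r" using p(2) r by simp
    moreover have "0 \<le> dot n (x - dot n x e *\<^sub>R e) (x - dot n x e *\<^sub>R e)"
      by (simp add: dot_def sum_nonneg)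
    then have "(dot n x e)\<^sup>2 \<le> dot n x x"
      using ee by (simp add: E.diff_left E.diff_right E.scale_left E.scale_right E.sym[of e x] power2_eq_square)
    ultimately have "(dot n x e)\<^sup>2 \<le> r\<^sup>2" by (simp add: power2_eq_square)
    then show "\<bar>dot n x e\<bar> \<le> r" using r(1) by (simp add: abs_le_square_iff[symmetric])
  qed
qed

text \<open>
  A substitute for an Auerbach basis, with constants \<open>2\<^sup>i\<close>: the points \<open>R\<^sub>i u\<^sub>i\<close> of \<open>K\<close> are almost dual
  to bounded functionals, and projecting out the span of the frame enlarges \<open>K\<close> by a bounded factor.
\<close>

definition greedy_frame :: "nat \<Rightarrow> (nat \<Rightarrow> nat \<Rightarrow> real) \<Rightarrow> (nat \<Rightarrow> real) \<Rightarrow> bool"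
  where "greedy_frame j u R \<longleftrightarrow> orthonormal_seq (dot n) j u \<and> u ` {..<j} \<subseteq> Rn n \<and>
    (\<forall>i<j. 0 < R i \<and> R i *\<^sub>R u i \<in> K \<and> (\<forall>x\<in>K. \<bar>dot n x (u i)\<bar> \<le> 2 ^ i * R i)) \<and>
    (\<forall>x\<in>K. (1 / 2 ^ j) *\<^sub>R proj_out j u x \<in> K)"

text \<open>
  Each step takes a farthest point orthogonal to the previous ones. If \<open>x \<in> K\<close> has the projection
  \<open>2\<^sup>j y\<close> with \<open>y \<in> K\<close>, then the new functional is at most \<open>R\<^sub>j\<close> at \<open>y\<close>. So removing the new
  component from \<open>y\<close> subtracts a point of \<open>K\<close>, and the factor doubles.
\<close>

lemma greedy_frame_exists:
  assumes "j \<le> n"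
  shows "\<exists>u R. greedy_frame j u R"
  using assms
proof (induction j)
  case 0
  then show ?case by (auto simp: greedy_frame_def orthonormal_seq_def proj_out_def)
next
  case (Suc j)
  then obtain u R where "greedy_frame j u R" by auto
  then have u: "orthonormal_seq (dot n) j u" "u ` {..<j} \<subseteq> Rn n"
    and R: "\<And>i. i < j \<Longrightarrow> 0 < R i" "\<And>i. i < j \<Longrightarrow> R i *\<^sub>R u i \<in> K"
      "\<And>i x. i < j \<Longrightarrow> x \<in> K \<Longrightarrow> \<bar>dot n x (u i)\<bar> \<le> 2 ^ i * R i"
    and P: "\<And>x. x \<in> K \<Longrightarrow> (1 / 2 ^ j) *\<^sub>R proj_out j u x \<in> K"
    unfolding greedy_frame_def by blast+
  have jn: "j < n" using Suc.prems by simp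
  obtain e r where r: "r > 0" and e: "e \<in> Rn n" "dot n e e = 1" "r *\<^sub>R e \<in> K"
      "\<And>i. i < j \<Longrightarrow> dot n e (u i) = 0"
    and far: "\<And>x. x \<in> K \<Longrightarrow> (\<And>i. i < j \<Longrightarrow> dot n x (u i) = 0) \<Longrightarrow> \<bar>dot n x e\<bar> \<le> r"
    using farthest_point[OF u jn] by metis
  define u' where "u' = u(j := e)"
  define R' where "R' = R(j := r)"
  have proj: "proj_out (Suc j) u' x = proj_out j u x - dot n x e *\<^sub>R e" for x
    by (simp add: proj_out_def u'_def)
  have ue: "dot n (u i) e = 0" if "i < j" for i
    using e(4)[OF that] E.sym[of "u i" e] by simp
  have pe: "dot n (proj_out j u x) e = dot n x e" for x
    using ue by (simp add: proj_out_def E.diff_left E.sum_left E.scale_left)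
  have bound: "\<bar>dot n ((1 / 2 ^ j) *\<^sub>R proj_out j u x) e\<bar> \<le> r" if "x \<in> K" for x
    using that proj_out_orth[OF u(1)] by (intro far P) (auto simp: E.scale_left)
  have "greedy_frame (Suc j) u' R'"
    unfolding greedy_frame_def
  proof (intro conjI allI impI ballI)
    show "orthonormal_seq (dot n) (Suc j) u'"
      using u(1) e(2,4) ue by (auto simp: orthonormal_seq_def u'_def less_Suc_eq)
    show "u' ` {..<Suc j} \<subseteq> Rn n" using u(2) e(1) by (auto simp: u'_def less_Suc_eq image_subset_iff)
  next
    fix i assume i: "i < Suc j"
    show "0 < R' i" "R' i *\<^sub>R u' i \<in> K"
      using i R r e(3) by (auto simp: R'_def u'_def less_Suc_eq)
    fix x assume x: "x \<in> K"
    show "\<bar>dot n x (u' i)\<bar> \<le> 2 ^ i * R' i"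
    proof (cases "i < j")
      case True
      then show ?thesis using R(3)[OF True x] by (simp add: R'_def u'_def)
    next
      case False
      then have "i = j" using i by simp
      then show ?thesis using bound[OF x] by (simp add: R'_def u'_def E.scale_left pe abs_mult field_simps)
    qed
  next
    fix x assume x: "x \<in> K"
    define y where "y = (1 / 2 ^ j) *\<^sub>R proj_out j u x"
    have y: "y \<in> K" unfolding y_def by (rule P[OF x])
    have ye: "dot n y e = dot n x e / 2 ^ j" by (simp add: y_def E.scale_left pe)
    have "\<bar>- dot n y e / (2 * r)\<bar> \<le> 1 / 2" using bound[OF x] r by (simp add: y_def[symmetric] abs_mult field_simps)
    then have "(1 / 2) *\<^sub>R y + (- dot n y e / (2 * r)) *\<^sub>R (r *\<^sub>R e) \<in> K"
      by (intro comb_mem y e(3)) auto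
    moreover have "(1 / 2) *\<^sub>R y + (- dot n y e / (2 * r)) *\<^sub>R (r *\<^sub>R e) = (1 / 2) *\<^sub>R y - (dot n x e / 2 ^ Suc j) *\<^sub>R e"
      using r by (simp add: ye)
    moreover have "\<dots> = (1 / 2 ^ Suc j) *\<^sub>R proj_out (Suc j) u' x"
      by (simp add: proj y_def scaleR_diff_right)
    ultimately show "(1 / 2 ^ Suc j) *\<^sub>R proj_out (Suc j) u' x \<in> K" by (simp only:)
  qed
  then show ?case by blast
qed

lemma moment_orthogonal:
  assumes "\<And>i. i < d \<Longrightarrow> dot n (b i) y = 0"
  shows "moment d b y z = 0"
proof -
  have "moment d b y z = (\<integral>c. indicator K (\<Sum>i<d. c i *\<^sub>R b i) * (dot n (\<Sum>i<d. c i *\<^sub>R b i) y * dot n (\<Sum>i<d. c i *\<^sub>R b i) z) \<partial>coord_measure d)"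
    unfolding moment_def frame_measure_def by (rule integral_distr[OF measurable_comb]) measurable
  also have "\<dots> = 0" using assms by (simp add: E.sum_left E.scale_left)
  finally show ?thesis .
qed

lemma moment_scale_self: "moment d b (r *\<^sub>R x) (r *\<^sub>R x) = r\<^sup>2 * moment d b x x"
  using moment_sym[of d b x "r *\<^sub>R x"] by (simp add: moment_scale power2_eq_square)

text \<open>
  That \<open>(1 / s) x\<close> lies in \<open>K\<close> means \<open>x \<in> s K\<close>, and \<open>s K + t K \<subseteq> (s + t) K\<close> for convex \<open>K\<close>.
\<close>

lemma add_mem:
  assumes "s > 0" "t > 0" "(1 / s) *\<^sub>R x \<in> K" "(1 / t) *\<^sub>R y \<in> K"
  shows "(1 / (s + t)) *\<^sub>R (x + y) \<in> K"
proof -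
  have "(s / (s + t)) *\<^sub>R ((1 / s) *\<^sub>R x) + (t / (s + t)) *\<^sub>R ((1 / t) *\<^sub>R y) \<in> K"
    using assms by (intro comb_mem) (auto simp: add_divide_distrib[symmetric])
  then show ?thesis using assms by (simp add: scaleR_add_right)
qed

lemma sum_mem:
  assumes "s > 0" "(1 / s) *\<^sub>R x \<in> K" "\<And>i. i < j \<Longrightarrow> y i \<in> K"
  shows "(1 / (s + real j)) *\<^sub>R (x + (\<Sum>i<j. y i)) \<in> K"
  using assms(3)
proof (induction j)
  case 0
  then show ?case using assms by simp
next
  case (Suc j)
  have "(1 / (s + real j)) *\<^sub>R (x + (\<Sum>i<j. y i)) \<in> K" "y j \<in> K" using Suc by auto
  then have "(1 / ((s + real j) + 1)) *\<^sub>R ((x + (\<Sum>i<j. y i)) + y j) \<in> K"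
    using assms(1) add_mem[of "s + real j" 1 "x + (\<Sum>i<j. y i)" "y j"] by simp
  then show ?case by (simp add: ac_simps)
qed

end

text \<open>
  \<open>D\<close> is the \<open>(m + 1)\<close>-intersection body of \<open>K\<close>, expressed through orthonormal bases.
\<close>

locale intersection_pair = K: sym_body n K + D: sym_body n D for n K D +
  fixes m :: nat
  assumes mn: "m + 2 \<le> n"
    and sections: "\<And>w. orthonormal_seq (dot n) n w \<Longrightarrow> w ` {..<n} \<subseteq> Rn n \<Longrightarrow>
      D.vol (Suc m) w = K.vol (n - Suc m) (\<lambda>i. w (Suc m + i))"
begin

definition complement_frame :: "(nat \<Rightarrow> nat \<Rightarrow> real) \<Rightarrow> (nat \<Rightarrow> nat \<Rightarrow> real) \<Rightarrow> bool"
  where "complement_frame u g \<longleftrightarrow> orthonormal_seq (dot n) (n - m) g \<and> g ` {..<n - m} \<subseteq> Rn n \<and>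
    span (g ` {..<n - m}) = {x \<in> Rn n. \<forall>i<m. dot n x (u i) = 0}"

lemma complement_frame_exists:
  assumes "orthonormal_seq (dot n) m u" "u ` {..<m} \<subseteq> Rn n"
  shows "\<exists>g. complement_frame u g"
proof -
  obtain w where w: "\<And>i. i < m \<Longrightarrow> w i = u i" "orthonormal_seq (dot n) n w" "w ` {..<n} \<subseteq> Rn n"
    using K.E.orthonormal_complete[OF assms] by metis
  have "complement_frame u (\<lambda>i. w (m + i))"
    unfolding complement_frame_def shift_image
    using orthonormal_shift[OF w(2)] w span_tail[OF w(2,3), of m] mn by auto
  then show ?thesis by blast
qed

text \<open>
  Let \<open>F\<close> be the span of \<open>u\<^sub>0, \<dots>, u\<^sub>m\<^sub>-\<^sub>1\<close>. Hensley's inequalities are applied to \<open>K \<inter> F\<^sup>\<bottom>\<close> and its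
  section orthogonal to \<open>v\<close>, whose volume is that of \<open>D \<inter> (F + \<real> v)\<close>. The frame \<open>g\<close> of \<open>F\<^sup>\<bottom>\<close> is
  the same for all \<open>v\<close>, so that the moments form one quadratic form; uniqueness of the measure allows
  to compute with a frame that ends with \<open>v\<close>.
\<close>

lemma section_moment:
  assumes u: "orthonormal_seq (dot n) m u" "u ` {..<m} \<subseteq> Rn n" and g: "complement_frame u g"
    and v: "v \<in> Rn n" "dot n v v = 1" "\<And>i. i < m \<Longrightarrow> dot n v (u i) = 0"
  defines "b \<equiv> u(m := v)"
  shows "orthonormal_seq (dot n) (Suc m) b"
    "K.vol (n - m) g ^ 3 \<le> 32 * (D.vol (Suc m) b)\<^sup>2 * K.moment (n - m) g v v"
    "(D.vol (Suc m) b)\<^sup>2 * K.moment (n - m) g v v \<le> 1024 * K.vol (n - m) g ^ 3"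
proof -
  show b: "orthonormal_seq (dot n) (Suc m) b"
  proof -
    have "dot n (u i) v = 0" if "i < m" for i using v(3)[OF that] K.E.sym[of "u i" v] by simp
    then show ?thesis using u(1) v(2,3) by (auto simp: b_def orthonormal_seq_def less_Suc_eq)
  qed
  have "b ` {..<Suc m} \<subseteq> Rn n" using u(2) v(1) by (auto simp: b_def less_Suc_eq image_subset_iff)
  then obtain w where w: "\<And>i. i < Suc m \<Longrightarrow> w i = b i" "orthonormal_seq (dot n) n w" "w ` {..<n} \<subseteq> Rn n"
    using K.E.orthonormal_complete[OF b] by metis
  \<comment> \<open>The same basis of the complement as in w, reordered so that v comes last.\<close>
  define c where "c = (\<lambda>i. if i < n - Suc m then w (Suc m + i) else v)"
  have wm: "w m = v" using w(1)[of m] by (simp add: b_def)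
  have nm: "n - m = Suc (n - Suc m)" using mn by simp
  have c: "orthonormal_seq (dot n) (n - m) c"
    unfolding orthonormal_seq_def
  proof (intro allI impI)
    define \<sigma> where "\<sigma> = (\<lambda>i. if i < n - Suc m then Suc m + i else m)"
    fix i j assume ij: "i < n - m" "j < n - m"
    have "c i = w (\<sigma> i)" "c j = w (\<sigma> j)" by (auto simp: c_def \<sigma>_def wm)
    moreover have "\<sigma> i < n" "\<sigma> j < n" "\<sigma> i = \<sigma> j \<longleftrightarrow> i = j" using ij mn by (auto simp: \<sigma>_def)
    ultimately show "dot n (c i) (c j) = (if i = j then 1 else 0)"
      using orthonormal_seqD[OF w(2)] by simp
  qed
  have "c ` {..<n - m} = insert v ((\<lambda>i. w (Suc m + i)) ` {..<n - Suc m})"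
    unfolding nm lessThan_Suc by (auto simp: c_def)
  also have "\<dots> = w ` {m..<n}"
  proof -
    have "{m..<n} = insert m {Suc m..<n}" using mn by auto
    then show ?thesis unfolding shift_image using wm by simp
  qed
  finally have "span (c ` {..<n - m}) = {x \<in> Rn n. \<forall>i<m. dot n x (w i) = 0}"
    using span_tail[OF w(2,3), of m] mn by simp
  also have "\<dots> = span (g ` {..<n - m})"
    using g w(1) by (auto simp: complement_frame_def b_def)
  finally have fr: "frame_measure (n - m) c = frame_measure (n - m) g"
    using g by (intro frame_measure_unique[OF c]) (auto simp: complement_frame_def)
  have "D.vol (Suc m) b = D.vol (Suc m) w"
    unfolding D.vol_def using w(1) by (intro arg_cong[of _ _ "\<lambda>M. measure M D"] frame_cong) auto
  also have "\<dots> = K.vol (n - Suc m) (\<lambda>i. w (Suc m + i))" by (rule sections[OF w(2,3)])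
  also have "\<dots> = K.vol (n - Suc m) c"
    unfolding K.vol_def by (intro arg_cong[of _ _ "\<lambda>M. measure M K"] frame_cong) (auto simp: c_def)
  finally have M: "D.vol (Suc m) b = K.vol (n - Suc m) c" .
  have cl: "c (n - Suc m) = v" by (simp add: c_def)
  note h = K.hensley[OF c[unfolded nm], unfolded cl M[symmetric]]
  have e: "K.vol (Suc (n - Suc m)) c = K.vol (n - m) g" "K.moment (Suc (n - Suc m)) c v v = K.moment (n - m) g v v"
    unfolding K.vol_def K.moment_def nm[symmetric] fr by simp_all
  show "K.vol (n - m) g ^ 3 \<le> 32 * (D.vol (Suc m) b)\<^sup>2 * K.moment (n - m) g v v"
    "(D.vol (Suc m) b)\<^sup>2 * K.moment (n - m) g v v \<le> 1024 * K.vol (n - m) g ^ 3"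
    using h unfolding e by auto
qed

text \<open>
  The projection of \<open>D\<close> to \<open>F\<^sup>\<bottom>\<close> lies in an ellipsoid. A point \<open>x\<close> of \<open>D\<close> with a long projection \<open>p\<close> spans
  a large cone over \<open>D \<inter> F\<close>. This makes the section of \<open>D\<close> by \<open>F + \<real> p\<close> large, so the moment of \<open>K\<close> in the
  direction \<open>p\<close> is small.
\<close>

lemma projection_upper:
  assumes u: "orthonormal_seq (dot n) m u" "u ` {..<m} \<subseteq> Rn n" and g: "complement_frame u g"
    and x: "x \<in> D"
  defines "p \<equiv> D.proj_out m u x"
  shows "(D.vol m u)\<^sup>2 * K.moment (n - m) g p p \<le> 1024 * 4 ^ Suc m * K.vol (n - m) g ^ 3"
proof (cases "p = 0")
  case True
  have "K.moment (n - m) g p p = 0" unfolding True by (simp add: K.moment_def)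
  then show ?thesis by (simp add: K.vol_def)
next
  case False
  have pR: "p \<in> Rn n" unfolding p_def using x D.Rn by (intro D.proj_out_Rn u) auto
  define t where "t = sqrt (dot n p p)"
  have t: "t > 0" "t * t = dot n p p" using K.E.pos[OF pR False] by (auto simp: t_def)
  define v where "v = (1 / t) *\<^sub>R p"
  have p: "p = t *\<^sub>R v" using t by (simp add: v_def)
  have v: "v \<in> Rn n" "dot n v v = 1" "\<And>i. i < m \<Longrightarrow> dot n v (u i) = 0"
    using t pR D.proj_out_orth[OF u(1)]
    by (auto simp: v_def K.E.scale_left K.E.scale_right p_def intro!: subspace_scale subspace_Rn)
  define b where "b = u(m := v)"
  note s = section_moment[OF u g v, folded b_def]
  have bs: "b ` {..<m} = u ` {..<m}" by (auto simp: b_def)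
  have "x = t *\<^sub>R b m + (\<Sum>i<m. dot n x (u i) *\<^sub>R u i)"
    unfolding b_def using p by (simp add: p_def D.proj_out_def algebra_simps)
  then have "t * D.vol m b \<le> 2 ^ Suc m * D.vol (Suc m) b"
    using x t comb_in_span[of "\<lambda>i. dot n x (u i)" u m]
    by (intro D.vol_cone_lower[OF s(1), of t "\<Sum>i<m. dot n x (u i) *\<^sub>R u i"]) (auto simp: bs)
  moreover have "D.vol m b = D.vol m u"
    unfolding D.vol_def by (intro arg_cong[of _ _ "\<lambda>M. measure M D"] frame_cong) (auto simp: b_def)
  ultimately have "t * D.vol m u \<le> 2 ^ Suc m * D.vol (Suc m) b" by simp
  then have "(t * D.vol m u)\<^sup>2 \<le> (2 ^ Suc m * D.vol (Suc m) b)\<^sup>2"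
    using t by (intro power_mono) (auto simp: D.vol_def)
  also have "(2 ^ Suc m * D.vol (Suc m) b)\<^sup>2 = 4 ^ Suc m * (D.vol (Suc m) b)\<^sup>2"
    by (simp add: power2_eq_square power_mult_distrib[symmetric])
  finally have "(t * D.vol m u)\<^sup>2 * K.moment (n - m) g v v \<le> 4 ^ Suc m * ((D.vol (Suc m) b)\<^sup>2 * K.moment (n - m) g v v)"
    using K.moment_nonneg[of "n - m" g v] by (metis mult.assoc mult_right_mono)
  also have "\<dots> \<le> 4 ^ Suc m * (1024 * K.vol (n - m) g ^ 3)"
    using s(3) by (intro mult_left_mono) auto
  also have "(t * D.vol m u)\<^sup>2 * K.moment (n - m) g v v = (D.vol m u)\<^sup>2 * K.moment (n - m) g p p"
    unfolding p by (simp add: K.moment_scale_self power_mult_distrib power_divide)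
  finally show ?thesis by simp
qed

text \<open>
  The converse inclusion. If \<open>D\<close> had no point in \<open>F + \<real> p\<close> with a large component along \<open>p\<close>, its section
  by that subspace would be contained in a thin slab. The moment of \<open>K\<close> along \<open>p\<close> would then be too
  large. The factor 7 is chosen because \<open>32 < 7\<^sup>2\<close>.
\<close>

lemma projection_lower:
  assumes u: "D.greedy_frame m u R" and g: "complement_frame u g"
    and p: "p \<in> Rn n" "\<And>i. i < m \<Longrightarrow> dot n p (u i) = 0"
    and le: "(D.vol m u)\<^sup>2 * K.moment (n - m) g p p \<le> K.vol (n - m) g ^ 3"
  shows "(1 / (7 * 4 ^ Suc m)) *\<^sub>R p \<in> D"
proof (cases "p = 0")
  case True
  then show ?thesis using D.zero_mem by simp
next
  case False
  have uo: "orthonormal_seq (dot n) m u" and uR: "u ` {..<m} \<subseteq> Rn n"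
    and P: "\<And>x. x \<in> D \<Longrightarrow> (1 / 2 ^ m) *\<^sub>R D.proj_out m u x \<in> D"
    using u unfolding D.greedy_frame_def by blast+
  define t where "t = sqrt (dot n p p)"
  have t: "t > 0" "t * t = dot n p p" using K.E.pos[OF p(1) False] by (auto simp: t_def)
  define v where "v = (1 / t) *\<^sub>R p"
  have pv: "p = t *\<^sub>R v" using t by (simp add: v_def)
  have v: "v \<in> Rn n" "dot n v v = 1" "\<And>i. i < m \<Longrightarrow> dot n v (u i) = 0"
    using t p by (auto simp: v_def K.E.scale_left K.E.scale_right intro!: subspace_scale subspace_Rn)
  define b where "b = u(m := v)"
  note s = section_moment[OF uo uR g v, folded b_def]
  have bm: "b m = v" by (simp add: b_def)
  have volb: "D.vol m b = D.vol m u"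
    unfolding D.vol_def by (intro arg_cong[of _ _ "\<lambda>M. measure M D"] frame_cong) (auto simp: b_def)
  define w where "w = t / (7 * 2 ^ Suc m)"
  have w: "w > 0" using t by (simp add: w_def)
  have S: "K.vol (n - m) g > 0" using g by (intro K.vol_pos) (auto simp: complement_frame_def)
  have "\<exists>z\<in>D. z \<in> span (b ` {..<Suc m}) \<and> \<bar>dot n z v\<bar> > w"
  proof (rule ccontr)
    assume "\<not> ?thesis"
    then have "D.vol (Suc m) b \<le> 2 ^ Suc m * w * D.vol m b"
      using w bm by (intro D.vol_slab_upper[OF s(1)]) (auto simp: not_less)
    also have "\<dots> = (1 / 7) * (t * D.vol m u)" by (simp add: w_def volb)
    finally have "(D.vol (Suc m) b)\<^sup>2 \<le> ((1 / 7) * (t * D.vol m u))\<^sup>2"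
      by (intro power_mono) (auto simp: D.vol_def)
    then have "(D.vol (Suc m) b)\<^sup>2 * K.moment (n - m) g v v \<le> ((1 / 7) * (t * D.vol m u))\<^sup>2 * K.moment (n - m) g v v"
      using K.moment_nonneg by (rule mult_right_mono)
    also have "\<dots> = (1 / 49) * ((D.vol m u)\<^sup>2 * K.moment (n - m) g p p)"
      unfolding pv by (simp add: K.moment_scale_self power_mult_distrib power_divide)
    finally have "32 * ((D.vol (Suc m) b)\<^sup>2 * K.moment (n - m) g v v) \<le> (32 / 49) * K.vol (n - m) g ^ 3"
      using le by linarith
    with s(2) have "K.vol (n - m) g ^ 3 \<le> (32 / 49) * K.vol (n - m) g ^ 3" by linarith
    moreover have "K.vol (n - m) g ^ 3 > 0" using S by simp
    ultimately show False by linarith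
  qed
  then obtain z where z: "z \<in> D" "z \<in> span (b ` {..<Suc m})" "\<bar>dot n z v\<bar> > w" by blast
  have "z = (\<Sum>i<Suc m. dot n z (b i) *\<^sub>R b i)" by (rule K.E.span_comb[OF s(1) z(2)])
  also have "\<dots> = (\<Sum>i<m. dot n z (u i) *\<^sub>R u i) + dot n z v *\<^sub>R v"
    by (simp add: b_def)
  finally have pz: "D.proj_out m u z = dot n z v *\<^sub>R v" unfolding D.proj_out_def by (metis add_diff_cancel_left')
  define r where "r = 2 ^ m * t / (7 * 4 ^ Suc m * dot n z v)"
  have four: "(4::real) ^ m = 2 ^ m * 2 ^ m" by (simp add: power_mult_distrib[symmetric])
  have zv: "dot n z v \<noteq> 0" using z(3) w by auto
  have "t \<le> \<bar>dot n z v\<bar> * (7 * 2 ^ Suc m)" using z(3) by (simp add: w_def field_simps)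
  then have "\<bar>r\<bar> \<le> 1"
    using zv t by (simp add: r_def abs_mult four field_simps)
  then have "r *\<^sub>R ((1 / 2 ^ m) *\<^sub>R (dot n z v *\<^sub>R v)) \<in> D"
    by (rule D.scale_mem[OF P[OF z(1), unfolded pz]])
  moreover have "r *\<^sub>R ((1 / 2 ^ m) *\<^sub>R (dot n z v *\<^sub>R v)) = (1 / (7 * 4 ^ Suc m)) *\<^sub>R p"
    using zv by (simp add: r_def pv)
  ultimately show ?thesis by simp
qed

lemma banach_mazur_bound:
  "banach_mazur_dist n D (unit_ball n)
    \<le> sqrt (real m * 4 ^ m + 1024 * 4 ^ Suc m) * (7 * 4 ^ Suc m + real m)"
proof -
  obtain u R where gr: "D.greedy_frame m u R" using D.greedy_frame_exists[of m] mn by auto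
  then have u: "orthonormal_seq (dot n) m u" "u ` {..<m} \<subseteq> Rn n"
    and R: "\<And>i. i < m \<Longrightarrow> 0 < R i" "\<And>i. i < m \<Longrightarrow> R i *\<^sub>R u i \<in> D"
      "\<And>i x. i < m \<Longrightarrow> x \<in> D \<Longrightarrow> \<bar>dot n x (u i)\<bar> \<le> 2 ^ i * R i"
    unfolding D.greedy_frame_def by blast+
  obtain g where g: "complement_frame u g" using complement_frame_exists[OF u] by blast
  then have go: "orthonormal_seq (dot n) (n - m) g" "g ` {..<n - m} \<subseteq> Rn n"
    and gs: "span (g ` {..<n - m}) = {x \<in> Rn n. \<forall>i<m. dot n x (u i) = 0}"
    by (auto simp: complement_frame_def)
  let ?Q = "K.moment (n - m) g"
  define S where "S = K.vol (n - m) g ^ 3"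
  define V where "V = (D.vol m u)\<^sup>2"
  have S: "S > 0" unfolding S_def using K.vol_pos[OF go] by simp
  have V: "V > 0" unfolding V_def using D.vol_pos[OF u] by simp
  \<comment> \<open>The ellipsoid: the greedy directions carry their radii, the complement carries the second moments.\<close>
  define q where "q = (\<lambda>x y. (\<Sum>i<m. dot n x (u i) * dot n y (u i) / (R i)\<^sup>2) + V / S * ?Q x y)"
  have Q0: "?Q (u i) y = 0" if "i < m" for i y
  proof (rule K.moment_orthogonal)
    fix j assume "j < n - m"
    then have "g j \<in> span (g ` {..<n - m})" by (intro span_base) auto
    then show "dot n (g j) (u i) = 0" using gs that by auto
  qed
  \<comment> \<open>The second moment form only sees the component in the complement of the frame.\<close>
  have Qproj: "?Q x x = ?Q (D.proj_out m u x) (D.proj_out m u x)" for x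
  proof -
    define y where "y = (\<Sum>i<m. dot n x (u i) *\<^sub>R u i)"
    have "?Q y z = 0" for z
    proof -
      have "?Q (\<Sum>i<j. dot n x (u i) *\<^sub>R u i) z = 0" if "j \<le> m" for j
        using that
      proof (induction j)
        case 0
        then show ?case by (simp add: K.moment_def)
      next
        case (Suc j)
        then show ?case using Q0[of j z] by (simp add: K.moment_add[OF go(1)] K.moment_scale)
      qed
      then show ?thesis by (simp add: y_def)
    qed
    moreover have "x = y + D.proj_out m u x" by (simp add: y_def D.proj_out_def)
    ultimately show ?thesis
      by (metis K.moment_add[OF go(1)] K.moment_sym add_0)
  qed
  have q_self: "q x x = (\<Sum>i<m. (dot n x (u i) / R i)\<^sup>2) + V / S * ?Q x x" for x
    by (simp add: q_def power2_eq_square power_divide)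
  have q_sum_nonneg: "0 \<le> V / S * ?Q x x" for x using V S K.moment_nonneg by simp
  have upper: "x \<in> Rn n \<and> q x x \<le> real m * 4 ^ m + 1024 * 4 ^ Suc m" if x: "x \<in> D" for x
  proof -
    have "(dot n x (u i) / R i)\<^sup>2 \<le> 4 ^ m" if i: "i < m" for i
    proof -
      have "\<bar>dot n x (u i) / R i\<bar> \<le> 2 ^ i" using R(1)[OF i] R(3)[OF i x] by (simp add: abs_mult field_simps)
      also have "\<dots> \<le> 2 ^ m" using i by simp
      finally have "(dot n x (u i) / R i)\<^sup>2 \<le> (2 ^ m)\<^sup>2"
        using abs_le_square_iff[of "dot n x (u i) / R i" "2 ^ m"] by simp
      also have "(2 ^ m)\<^sup>2 = (4 :: real) ^ m" by (simp add: power2_eq_square power_mult_distrib[symmetric])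
      finally show ?thesis .
    qed
    then have "(\<Sum>i<m. (dot n x (u i) / R i)\<^sup>2) \<le> (\<Sum>i<m. 4 ^ m)" by (intro sum_mono) auto
    moreover have "V / S * ?Q x x \<le> 1024 * 4 ^ Suc m"
      using projection_upper[OF u g x] S unfolding Qproj[of x] V_def[symmetric] S_def[symmetric]
      by (simp add: field_simps)
    ultimately show ?thesis using x D.Rn unfolding q_self by auto
  qed
  have lower: "(1 / (7 * 4 ^ Suc m + real m)) *\<^sub>R x \<in> D" if x: "x \<in> Rn n" "q x x \<le> 1" for x
  proof -
    let ?p = "D.proj_out m u x"
    have sn: "0 \<le> (\<Sum>i<m. (dot n x (u i) / R i)\<^sup>2)" by (intro sum_nonneg) auto
    then have "V / S * ?Q x x \<le> 1" using x(2) unfolding q_self by linarith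
    then have "V * ?Q ?p ?p \<le> S" using S unfolding Qproj[of x] by (simp add: field_simps)
    then have p: "(1 / (7 * 4 ^ Suc m)) *\<^sub>R ?p \<in> D"
      unfolding V_def S_def using D.proj_out_orth[OF u(1)] D.proj_out_Rn[OF u(2) x(1)]
      by (intro projection_lower[OF gr g]) auto
    have "dot n x (u i) *\<^sub>R u i \<in> D" if i: "i < m" for i
    proof -
      have "(dot n x (u i) / R i)\<^sup>2 \<le> (\<Sum>i<m. (dot n x (u i) / R i)\<^sup>2)"
        using i by (intro member_le_sum) auto
      also have "\<dots> \<le> 1" using x(2) q_sum_nonneg[of x] unfolding q_self by linarith
      finally have "\<bar>dot n x (u i) / R i\<bar> \<le> 1" by (simp add: abs_square_le_1)
      then have "(dot n x (u i) / R i) *\<^sub>R (R i *\<^sub>R u i) \<in> D" by (intro D.scale_mem R(2)[OF i])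
      then show ?thesis using R(1)[OF i] by simp
    qed
    then have "(1 / (7 * 4 ^ Suc m + real m)) *\<^sub>R (?p + (\<Sum>i<m. dot n x (u i) *\<^sub>R u i)) \<in> D"
      by (intro D.sum_mem p) auto
    then show ?thesis by (simp add: D.proj_out_def)
  qed
  have inner: "inner_form n q"
  proof
    show "q (x + y) z = q x z + q y z" for x y z
      by (simp add: q_def K.moment_add[OF go(1)] K.E.add_left distrib_right distrib_left add_divide_distrib sum.distrib)
    show "q (r *\<^sub>R x) z = r * q x z" for r x z
      by (simp add: q_def K.moment_scale K.E.scale_left distrib_left sum_distrib_left mult.assoc mult.left_commute)
    show "q x y = q y x" for x y
      unfolding q_def using K.moment_sym[of "n - m" g x y] by (simp add: mult.commute)
    fix x assume x: "x \<in> Rn n" "x \<noteq> 0"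
    have scale: "q (r *\<^sub>R x) (r *\<^sub>R x) = r * r * q x x" for r
      unfolding q_self using K.moment_sym[of "n - m" g x "r *\<^sub>R x"]
      by (simp add: K.moment_scale K.E.scale_left power2_eq_square distrib_left sum_distrib_left mult_ac)
    have "0 \<le> q x x" unfolding q_self using q_sum_nonneg[of x] by (intro add_nonneg_nonneg sum_nonneg) auto
    moreover have "q x x \<noteq> 0"
    proof
      assume q0: "q x x = 0"
      obtain B where B: "B > 0" "\<forall>x\<in>D. dot n x x \<le> B\<^sup>2" using D.bounded by blast
      define C :: real where "C = 7 * 4 ^ Suc m + real m"
      have C: "C > 0" by (simp add: C_def add_pos_nonneg)
      have xx: "dot n x x > 0" by (rule K.E.pos[OF x])
      \<comment> \<open>A null vector of the form would have arbitrarily large multiples in a fixed multiple of the body.\<close>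
      define r where "r = (C * (B + 1)) / sqrt (dot n x x)"
      have "(1 / C) *\<^sub>R (r *\<^sub>R x) \<in> D"
        unfolding C_def using x(1) scale[of r] q0 by (intro lower subspace_scale subspace_Rn) auto
      then have "dot n ((1 / C) *\<^sub>R (r *\<^sub>R x)) ((1 / C) *\<^sub>R (r *\<^sub>R x)) \<le> B\<^sup>2" using B(2) by blast
      also have "dot n ((1 / C) *\<^sub>R (r *\<^sub>R x)) ((1 / C) *\<^sub>R (r *\<^sub>R x)) = (B + 1)\<^sup>2"
        using C xx by (simp add: K.E.scale_left K.E.scale_right r_def power2_eq_square field_simps)
      finally show False using B(1) by (simp add: power2_eq_square algebra_simps)
    qed
    ultimately show "0 < q x x" by simp
  qed
  show ?thesis
    by (rule banach_mazur_le[OF inner _ _ upper lower]) (auto intro: add_nonneg_pos add_pos_nonneg)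
qed

end

theorem theorem1p2:
  shows "\<forall>k::nat. k \<ge> 1 \<longrightarrow>
    (\<exists>c::real. \<forall>n::nat. n \<ge> k + 1 \<longrightarrow>
      (\<forall>K D :: (nat \<Rightarrow> real) set.
        convex_body n K \<and> symmetric K \<and> is_intersection_body n k K D \<and> convex D \<longrightarrow>
        banach_mazur_dist n D (unit_ball n) \<le> c))"
proof (intro allI impI)
  fix k :: nat assume "k \<ge> 1"
  then obtain m where k: "k = Suc m" by (cases k) auto
  show "\<exists>c::real. \<forall>n::nat. n \<ge> k + 1 \<longrightarrow>
      (\<forall>K D :: (nat \<Rightarrow> real) set.
        convex_body n K \<and> symmetric K \<and> is_intersection_body n k K D \<and> convex D \<longrightarrow>
        banach_mazur_dist n D (unit_ball n) \<le> c)"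
  proof (intro exI allI impI)
    fix n :: nat and K D :: "(nat \<Rightarrow> real) set"
    assume n: "n \<ge> k + 1"
      and A: "convex_body n K \<and> symmetric K \<and> is_intersection_body n k K D \<and> convex D"
    interpret K: sym_body n K
      using A by (intro sym_body_if_star_body) (auto simp: is_intersection_body_def convex_body_def)
    interpret D: sym_body n D
      using A by (intro sym_body_if_star_body) (auto simp: is_intersection_body_def)
    interpret intersection_pair n K D m
    proof
      show "m + 2 \<le> n" using n k by simp
      fix w :: "nat \<Rightarrow> nat \<Rightarrow> real"
      assume w: "orthonormal_seq (dot n) n w" "w ` {..<n} \<subseteq> Rn n"
      show "D.vol (Suc m) w = K.vol (n - Suc m) (\<lambda>i. w (Suc m + i))"
        unfolding D.vol_def K.vol_def using A k
        by (intro intersection_body_frames[OF _ K.borel D.borel w]) auto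
    qed
    show "banach_mazur_dist n D (unit_ball n)
      \<le> sqrt (real m * 4 ^ m + 1024 * 4 ^ Suc m) * (7 * 4 ^ Suc m + real m)"
      by (rule banach_mazur_bound)
  qed
qed

end
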